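(* Let $n\ge 1$, let $\Omega\subset\mathbb{R}^{n+1}$ be open, let $\varphi\in C^2(\Omega,\mathbb{R})$, let $c\geq 0$ be a real constant, and let $f\in L^2(\Omega,\mathcal{A},\varphi)$. (i) If $$|(f,\alpha)_\varphi|_0^2\le c\,\|\overline{D}^*_\varphi\alpha\|^2=c\int_\Omega|\overline{D}^*_\varphi\alpha|_0^2e^{-\varphi}\,dx\qquad\text{for all }\alpha\in C_0^\infty(\Omega,\mathcal{A}),\qquad( * )$$ then there exists $u\in L^2(\Omega,\mathcal{A},\varphi)$ such that $\overline{D}u=f$ in the weak sense on $\Omega$ and $$\|u\|^2=\int_\Omega|u|_0^2e^{-\varphi}\,dx\le 2^{2n}c.$$ (ii) Conversely, if there exists $u\in L^2(\Omega,\mathcal{A},\varphi)$ such that $\overline{D}u=f$ in the weak sense on $\Omega$ and $\|u\|^2\le c$, then the inequality $( * )$ holds.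
   Context: Clifford algebra: $\mathcal{A}$ is the real $2^n$-dimensional unital associative algebra generated by $e_1,\dots,e_n$ with $e_0=1$ the unit, $e_ie_j+e_je_i=0$ for $1\le i\neq j\le n$ and $e_i^2=-1$ for $1\le i\le n$; its basis is $e_A=e_{h_1}\cdots e_{h_r}$ for $A=\{h_1<\dots<h_r\}\subset\{1,\dots,n\}$, with $e_\emptyset=e_0$. The involution is $\overline{a}=\sum_A a_A\overline{e}_A$ for $a=\sum_A a_Ae_A$, $a_A\in\mathbb{R}$, where $\overline{e}_A=(-1)^{|A|(|A|+1)/2}e_A$. The norm on $\mathcal{A}$ is $|a|_0=\big(2^n\sum_A a_A^2\big)^{1/2}$. Operators: points of $\mathbb{R}^{n+1}$ are $x=(x_0,\dots,x_n)$; for $g=\sum_A g_Ae_A$, $\overline{D}g=\sum_{i=0}^n\sum_A e_ie_A\partial_{x_i}g_A$, $Dg=\sum_{i=0}^n\sum_A\overline{e}_ie_A\partial_{x_i}g_A$, and $g\overline{D}=\sum_{i=0}^n\sum_A e_Ae_i\partial_{x_i}g_A$. Spaces: $C_0^\infty(\Omega,\mathcal{A})$ is the set of $\mathcal{A}$-valued functions all of whose components are real-valued, smooth and compactly supported in $\Omega$. $L^2(\Omega,\mathcal{A},\varphi)$ is the set of $f=\sum_A f_Ae_A:\Omega\to\mathcal{A}$ with $\int_\Omega|f_A|^2e^{-\varphi}dx<\infty$ for all $A$; on it $(f,g)_\varphi=\int_\Omega\overline{f(x)}\,g(x)\,e^{-\varphi(x)}dx\in\mathcal{A}$ and $\|f\|^2=\int_\Omega|f|_0^2e^{-\varphi}dx$.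 Dual operator: for $\alpha\in C_0^\infty(\Omega,\mathcal{A})$, $\overline{D}^*_\varphi\alpha=-e^{\varphi}D(\alpha e^{-\varphi})$. Weak solution: $\overline{D}u=f$ in the weak sense on $\Omega$ means $\int_\Omega\alpha f\,dx=-\int_\Omega(\alpha\overline{D})u\,dx$ for every $\alpha\in C_0^\infty(\Omega,\mathcal{A})$. *)

theory Defs
  imports "HOL-Analysis.Analysis"
begin

text \<open>
  The index type \<open>'n\<close>, finite, linearly ordered and (like every type) nonempty, plays the role of
  \<open>{1, ..., n}\<close>, so that \<open>n = CARD('n) \<ge> 1\<close>.  An element of the Clifford algebra is
  the vector of its coordinates \<open>a $ A\<close> with respect to the basis \<open>e\<^sub>A\<close>, \<open>A \<subseteq> {1, ..., n}\<close>.
  The componentwise product that the library puts on vectors is not used; the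
  Clifford product is the operation \<open>\<odot>\<close> below.
  Points of \<open>n + 1\<close>-dimensional space are indexed by \<open>'n option\<close>: \<open>x $ None\<close> is the coordinate
  \<open>x\<^sub>0\<close> and \<open>x $ Some i\<close> is \<open>x\<^sub>i\<close>.
\<close>

type_synonym 'n clifford = "real ^ 'n set"
type_synonym 'n point = "real ^ 'n option"

section \<open>The Clifford algebra\<close>

definition blade :: "'n set \<Rightarrow> 'n::{finite,linorder} clifford" where
  "blade A = axis A 1"

definition gen :: "'n option \<Rightarrow> 'n::{finite,linorder} clifford" where
  "gen i = blade (set_option i)"

text \<open>
  \<open>e\<^sub>A e\<^sub>B\<close> is \<open>e\<^sub>C\<close> up to sign, \<open>C\<close> being the symmetric difference of \<open>A\<close> and \<open>B\<close>.  Each pair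
  \<open>b < a\<close> contributes a sign from interchanging \<open>e\<^sub>a\<close> and \<open>e\<^sub>b\<close>, and each pair \<open>b = a\<close> a sign from
  \<open>e\<^sub>a e\<^sub>a = -1\<close>.  That this is the algebra with the required generators and relations
  is proved in the lemmas that follow.
\<close>

definition blade_sign :: "'n::{finite,linorder} set \<Rightarrow> 'n set \<Rightarrow> real" where
  "blade_sign A B = (\<Prod>a\<in>A. \<Prod>b\<in>B. if b \<le> a then -1 else 1)"

definition cmult :: "'n::{finite,linorder} clifford \<Rightarrow> 'n clifford \<Rightarrow> 'n clifford" (infixl \<open>\<odot>\<close> 70) where
  "a \<odot> b = (\<Sum>A\<in>UNIV. \<Sum>B\<in>UNIV.
      (a $ A * b $ B * blade_sign A B) *\<^sub>R blade (sym_diff A B))"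

definition cconj :: "'n::{finite,linorder} clifford \<Rightarrow> 'n clifford" where
  "cconj a = (\<Sum>A\<in>UNIV. (a $ A * (-1) ^ (card A * (card A + 1) div 2)) *\<^sub>R blade A)"

definition norm0 :: "'n::{finite,linorder} clifford \<Rightarrow> real" where
  "norm0 a = sqrt (2 ^ CARD('n) * (\<Sum>A\<in>UNIV. (a $ A)\<^sup>2))"

lemma clifford_expand: "a = (\<Sum>A\<in>UNIV. (a $ A) *\<^sub>R blade A)"
  for a :: "'n::{finite,linorder} clifford"
  by (simp add: vec_eq_iff blade_def axis_def if_distrib[of "\<lambda>x. _ * x"] cong: if_cong)

lemma bilinear_cmult: "bilinear (\<odot>)"
  unfolding bilinear_def
  by (auto intro!: linearI simp: cmult_def algebra_simps sum.distrib scaleR_sum_right)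

lemma blade_cmult_blade: "blade A \<odot> blade B = blade_sign A B *\<^sub>R blade (sym_diff A B)"
proof -
  have "blade A \<odot> blade B = (\<Sum>A'\<in>UNIV. \<Sum>B'\<in>UNIV. if B' = B then (if A' = A then
      blade_sign A B *\<^sub>R blade (sym_diff A B) else 0) else 0)"
    unfolding cmult_def by (intro sum.cong refl) (auto simp: blade_def axis_def)
  then show ?thesis by simp
qed

lemma prod_sym_diff_signs:
  fixes t :: "'a \<Rightarrow> real"
  assumes "finite A" "finite B" and t: "\<And>x. t x * t x = 1"
  shows "prod t (sym_diff A B) = prod t A * prod t B"
proof -
  have 1: "prod t (A \<inter> B) * prod t (A \<inter> B) = 1"
    by (simp add: t flip: prod.distrib)
  have "prod t A = prod t (A \<inter> B) * prod t (A - B)"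
       "prod t B = prod t (A \<inter> B) * prod t (B - A)"
    using assms prod.Int_Diff[of A t B] prod.Int_Diff[of B t A] by (auto simp: Int_commute)
  moreover have "prod t (sym_diff A B) = prod t (A - B) * prod t (B - A)"
    using assms by (intro prod.union_disjoint) auto
  ultimately show ?thesis
    using 1 by (simp add: mult_ac)
qed

lemma blade_sign_sym_diff_left: "blade_sign (sym_diff A B) C = blade_sign A C * blade_sign B C"
  unfolding blade_sign_def
  by (rule prod_sym_diff_signs) (auto simp flip: prod.distrib intro!: prod.neutral)

lemma blade_sign_sym_diff_right: "blade_sign A (sym_diff B C) = blade_sign A B * blade_sign A C"
proof -
  have "blade_sign A (sym_diff B C) =
    (\<Prod>a\<in>A. (\<Prod>b\<in>B. if b \<le> a then -1 else 1) * (\<Prod>b\<in>C. if b \<le> a then -1 else 1))"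
    unfolding blade_sign_def by (intro prod.cong refl prod_sym_diff_signs) auto
  then show ?thesis by (simp add: blade_sign_def prod.distrib)
qed

lemma cmult_sum_left: "(\<Sum>i\<in>I. f i) \<odot> b = (\<Sum>i\<in>I. f i \<odot> b)"
  by (rule linear_sum[of "\<lambda>a. a \<odot> b"]) (simp add: bilinear_cmult[unfolded bilinear_def])

lemma cmult_sum_right: "b \<odot> (\<Sum>i\<in>I. f i) = (\<Sum>i\<in>I. b \<odot> f i)"
  by (rule linear_sum[of "\<lambda>a. b \<odot> a"]) (simp add: bilinear_cmult[unfolded bilinear_def])

lemmas cmult_scaleR = bilinear_lmul[OF bilinear_cmult] bilinear_rmul[OF bilinear_cmult]

lemma cmult_assoc: "(a \<odot> b) \<odot> c = a \<odot> (b \<odot> c)"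
  for a b c :: "'n::{finite,linorder} clifford"
proof -
  have blades: "(blade A \<odot> blade B) \<odot> blade C = blade A \<odot> (blade B \<odot> blade C)" for A B C :: "'n set"
  proof -
    have "sym_diff (sym_diff A B) C = sym_diff A (sym_diff B C)" by auto
    then show ?thesis
      by (simp add: blade_cmult_blade cmult_scaleR blade_sign_sym_diff_left
          blade_sign_sym_diff_right mult_ac)
  qed
  have c: "(blade A \<odot> blade B) \<odot> c = blade A \<odot> (blade B \<odot> c)" for A B
    by (subst (1 2) clifford_expand[of c]) (simp add: cmult_sum_right cmult_scaleR blades)
  have b: "(blade A \<odot> b) \<odot> c = blade A \<odot> (b \<odot> c)" for A
    by (subst (1 2) clifford_expand[of b])
      (simp add: cmult_sum_left cmult_sum_right cmult_scaleR c)
  show ?thesis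
    by (subst (1 2) clifford_expand[of a]) (simp add: cmult_sum_left cmult_scaleR b)
qed

lemma cmult_unit: "gen None \<odot> a = a" "a \<odot> gen None = a"
proof -
  have "gen None \<odot> blade A = blade A" "blade A \<odot> gen None = blade A" for A :: "'a set"
    by (simp_all add: gen_def blade_cmult_blade blade_sign_def)
  then show "gen None \<odot> a = a" "a \<odot> gen None = a"
    by (subst (1 2) clifford_expand[of a],
        simp add: cmult_sum_left cmult_sum_right cmult_scaleR)+
qed

lemma gen_square: "gen (Some i) \<odot> gen (Some i) = - gen None"
  by (simp add: gen_def blade_cmult_blade blade_sign_def)

lemma gen_anticommute:
  assumes "i \<noteq> j"
  shows "gen (Some i) \<odot> gen (Some j) + gen (Some j) \<odot> gen (Some i) = 0"
proof -
  have "{i} - {j} = {i}" "{j} - {i} = {j}" using assms by auto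
  then show ?thesis
    using assms by (auto simp: gen_def blade_cmult_blade blade_sign_def insert_commute)
qed

lemma blade_eq_ordered_product:
  "sorted_wrt (<) hs \<Longrightarrow> blade (set hs) = foldr (\<odot>) (map (\<lambda>h. gen (Some h)) hs) (gen None)"
proof (induction hs)
  case (Cons h hs)
  have "blade_sign {h} (set hs) = 1"
    unfolding blade_sign_def using Cons.prems by (auto intro!: prod.neutral)
  moreover have "sym_diff {h} (set hs) = insert h (set hs)" using Cons.prems by auto
  ultimately have "blade (set (h # hs)) = gen (Some h) \<odot> blade (set hs)"
    by (simp add: gen_def blade_cmult_blade)
  then show ?case using Cons by simp
qed (simp add: gen_def)

section \<open>Differential operators\<close>

text \<open>
  \<open>k\<close> times continuously differentiable; meant for open \<open>S\<close>, where the values of \<open>g\<close> outside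
  \<open>S\<close> are irrelevant.
\<close>

fun Ck_on :: "nat \<Rightarrow> 'a::euclidean_space set \<Rightarrow> ('a \<Rightarrow> real) \<Rightarrow> bool" where
  "Ck_on 0 S g \<longleftrightarrow> continuous_on S g"
| "Ck_on (Suc k) S g \<longleftrightarrow>
     (\<forall>x\<in>S. g differentiable (at x)) \<and>
     (\<forall>v\<in>Basis. Ck_on k S (\<lambda>x. frechet_derivative g (at x) v))"

text \<open>For differentiable \<open>g\<close>, \<open>pd i g\<close> is the partial derivative in the coordinate \<open>x\<^sub>i\<close>.\<close>

definition pd :: "'n option \<Rightarrow> ('n::{finite,linorder} point \<Rightarrow> real) \<Rightarrow> 'n point \<Rightarrow> real" where
  "pd i g x = frechet_derivative g (at x) (axis i 1)"

definition Dop :: "('n::{finite,linorder} point \<Rightarrow> 'n clifford) \<Rightarrow> 'n point \<Rightarrow> 'n clifford" where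
  "Dop g x = (\<Sum>i\<in>UNIV. \<Sum>A\<in>UNIV. pd i (\<lambda>y. g y $ A) x *\<^sub>R (cconj (gen i) \<odot> blade A))"

text \<open>
  In \<open>Dop\<close> the generators act from the left, conjugated; here they act from the right,
  unconjugated.
\<close>

definition Dbar_right :: "('n::{finite,linorder} point \<Rightarrow> 'n clifford) \<Rightarrow> 'n point \<Rightarrow> 'n clifford" where
  "Dbar_right g x = (\<Sum>i\<in>UNIV. \<Sum>A\<in>UNIV. pd i (\<lambda>y. g y $ A) x *\<^sub>R (blade A \<odot> gen i))"

definition Dbar_dual ::
  "('n::{finite,linorder} point \<Rightarrow> real) \<Rightarrow> ('n point \<Rightarrow> 'n clifford) \<Rightarrow> 'n point \<Rightarrow> 'n clifford" where
  "Dbar_dual \<phi> \<alpha> x = - (exp (\<phi> x) *\<^sub>R Dop (\<lambda>y. exp (- \<phi> y) *\<^sub>R \<alpha> y) x)"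

section \<open>Function spaces and weak solutions\<close>

text \<open>Test functions on \<open>\<Omega>\<close> are regarded as extended by zero to the whole space.\<close>

definition test_functions ::
  "'n::{finite,linorder} point set \<Rightarrow> ('n point \<Rightarrow> 'n clifford) set" where
  "test_functions \<Omega> = {\<alpha>.
     (\<forall>A k. Ck_on k UNIV (\<lambda>x. \<alpha> x $ A)) \<and>
     compact (closure {x. \<alpha> x \<noteq> 0}) \<and> closure {x. \<alpha> x \<noteq> 0} \<subseteq> \<Omega>}"

definition L2 ::
  "'n::{finite,linorder} point set \<Rightarrow> ('n point \<Rightarrow> real) \<Rightarrow> ('n point \<Rightarrow> 'n clifford) set" where
  "L2 \<Omega> \<phi> = {f. \<forall>A.
     (\<lambda>x. f x $ A) \<in> borel_measurable (lebesgue_on \<Omega>) \<and>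
     integrable (lebesgue_on \<Omega>) (\<lambda>x. \<bar>f x $ A\<bar>\<^sup>2 * exp (- \<phi> x))}"

definition ip ::
  "'n::{finite,linorder} point set \<Rightarrow> ('n point \<Rightarrow> real) \<Rightarrow>
     ('n point \<Rightarrow> 'n clifford) \<Rightarrow> ('n point \<Rightarrow> 'n clifford) \<Rightarrow> 'n clifford" where
  "ip \<Omega> \<phi> f g = (LINT x|lebesgue_on \<Omega>. exp (- \<phi> x) *\<^sub>R (cconj (f x) \<odot> g x))"

definition norm_sq ::
  "'n::{finite,linorder} point set \<Rightarrow> ('n point \<Rightarrow> real) \<Rightarrow> ('n point \<Rightarrow> 'n clifford) \<Rightarrow> real" where
  "norm_sq \<Omega> \<phi> f = (LINT x|lebesgue_on \<Omega>. (norm0 (f x))\<^sup>2 * exp (- \<phi> x))"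

definition weak_solution ::
  "'n::{finite,linorder} point set \<Rightarrow> ('n point \<Rightarrow> 'n clifford) \<Rightarrow> ('n point \<Rightarrow> 'n clifford) \<Rightarrow> bool" where
  "weak_solution \<Omega> u f \<longleftrightarrow>
     (\<forall>\<alpha>\<in>test_functions \<Omega>.
        (LINT x|lebesgue_on \<Omega>. \<alpha> x \<odot> f x) = - (LINT x|lebesgue_on \<Omega>. Dbar_right \<alpha> x \<odot> u x))"

end

(*
  In coordinates the weak equation says that defect b = INT b f + SUM_i INT (d_i b) (e_i u)
  vanishes for every scalar test function b.  Only first derivatives of b occur, so by
  mollification the identity extends to compactly supported C^1 functions b.  This is needed
  because the pairing (f, alpha) - (u, D* alpha) is a combination of the defects of the
  functions exp(-phi) alpha_A, which are no smoother than phi.  Given the weak equation, the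
  pairing vanishes and Cauchy-Schwarz yields the inequality.  Conversely, the inequality bounds
  the functional sending D* alpha to the scalar part of (f, alpha) on a subspace of L^2; a Riesz
  representative u makes the scalar parts of all pairings vanish, which tested with b e_A gives
  every coordinate of the defect of exp(-phi) b, and C^1 functions b of the form exp(phi) w
  reach all test functions w.
*)
theory Submission
  imports Defs
begin

section \<open>Norm and conjugation of the Clifford algebra\<close>

text \<open>The scalar part of conj(a) b is the Euclidean inner product of coordinate vectors, so
  the Clifford-valued duality becomes a real Hilbert space problem, and v = exp(-phi/2) u removes
  the weight from it. The factor 2^n in |.|_0 acts differently in the two directions. For the
  inequality, it makes |.|_0 submultiplicative, so Cauchy-Schwarz costs no constant. For existence,
  it cancels: a scalar part r of a satisfies 2^n r^2 <= |a|_0^2, and \<open>norm_sq\<close> is 2^n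
  times a Euclidean integral. The Riesz representative therefore has Euclidean norm squared at most
  c, so that \<open>norm_sq\<close> of u is at most 2^n c, which is below 2^(2n) c. The analytic
  obstacle is that phi is controlled only on Omega and has finitely many derivatives: a product of
  exp(phi) or exp(-phi) with a test function must be glued to zero off a compact subset of Omega,
  and is then only known to be C^1.\<close>

lemma blade_sign_square: "blade_sign A B * blade_sign A B = 1"
  unfolding blade_sign_def by (simp flip: prod.distrib) (auto intro!: prod.neutral)

text \<open>Among the pairs in A x A, exactly |A|(|A|+1)/2 satisfy b <= a. Hence the sign in the
  conjugation is that of e_A e_A, which gives conj(e_A) e_A = 1 and lets conjugation be computed
  with the rules for \<open>blade_sign\<close>.\<close>

lemma blade_sign_self:
  "blade_sign A A = (-1) ^ (card A * (card A + 1) div 2)" for A :: "'n::{finite,linorder} set"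
  using finite[of A]
proof (induction A rule: finite_linorder_max_induct)
  case empty
  then show ?case by (simp add: blade_sign_def)
next
  case (insert m A)
  have m: "m \<notin> A" using insert.hyps by auto
  \<comment> \<open>As \<open>m\<close> is the maximum, the pairs with first entry \<open>m\<close>
    contribute \<open>card A + 1\<close> signs, and a pair (a, m) with a < m contributes
    none.\<close>
  have 1: "(\<Prod>b\<in>insert m A. if b \<le> m then -1 else 1) = (-1 :: real) ^ (card A + 1)"
    using insert.hyps m by (subst prod.cong[OF refl, where h = "\<lambda>_. -1"]) (auto simp: less_imp_le)
  have "(\<Prod>b\<in>insert m A. if b \<le> a then -1 else 1) = (\<Prod>b\<in>A. if b \<le> a then -1 else (1::real))" if "a \<in> A" for a
    using insert.hyps m that by (subst prod.insert) auto
  then have 2: "(\<Prod>a\<in>A. \<Prod>b\<in>insert m A. if b \<le> a then -1 else 1) = blade_sign A A"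
    by (simp add: blade_sign_def)
  have "blade_sign (insert m A) (insert m A) = (-1) ^ (card A + 1) * blade_sign A A"
    using insert.hyps m unfolding 1[symmetric] 2[symmetric] by (simp add: blade_sign_def[of "insert m A"])
  also have "\<dots> = (-1) ^ (card A + 1 + card A * (card A + 1) div 2)"
    by (simp only: insert.IH power_add)
  also have "card A + 1 + card A * (card A + 1) div 2 = card (insert m A) * (card (insert m A) + 1) div 2"
    using insert.hyps m by simp
  finally show ?case .
qed

lemma cconj_alt: "cconj a = (\<Sum>A\<in>UNIV. (a $ A * blade_sign A A) *\<^sub>R blade A)"
  by (simp add: cconj_def blade_sign_self)

lemma linear_cconj: "linear cconj"
  by (rule linearI) (simp_all add: cconj_def algebra_simps sum.distrib scaleR_sum_right)

lemma cconj_blade: "cconj (blade A) = blade_sign A A *\<^sub>R blade A"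
proof -
  have "cconj (blade A) = (\<Sum>B\<in>UNIV. if B = A then blade_sign A A *\<^sub>R blade A else 0)"
    unfolding cconj_alt by (intro sum.cong refl) (auto simp: blade_def axis_def)
  then show ?thesis by simp
qed

lemma blade_nth: "blade A $ B = (if A = B then 1 else 0)"
  by (auto simp: blade_def axis_def)

text \<open>On blades this is bimultiplicativity of the sign s: s(A,B) s(A+B,A+B), with + the
  symmetric difference, contains s(A,B) twice, and what remains is s(A,A) s(B,B) s(B,A). Bilinearity
  extends it to all elements.\<close>

lemma cconj_cmult: "cconj (a \<odot> b) = cconj b \<odot> cconj a"
proof -
  have blades: "cconj (blade A \<odot> blade B) = cconj (blade B) \<odot> cconj (blade A)" for A B :: "'a set"
  proof -
    have "sym_diff B A = sym_diff A B" by auto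
    moreover have "blade_sign A B * (blade_sign A B * x) = x" for x
      by (simp add: blade_sign_square flip: mult.assoc)
    ultimately show ?thesis
      by (simp add: blade_cmult_blade cconj_blade cmult_scaleR linear_scale[OF linear_cconj]
          blade_sign_sym_diff_left blade_sign_sym_diff_right mult_ac)
  qed
  have b: "cconj (blade A \<odot> b) = cconj b \<odot> cconj (blade A)" for A
    by (subst (1 2) clifford_expand[of b])
      (simp add: cmult_sum_left cmult_sum_right cmult_scaleR linear_sum[OF linear_cconj]
        linear_scale[OF linear_cconj] blades)
  show ?thesis
    by (subst (1 2) clifford_expand[of a])
      (simp add: cmult_sum_left cmult_sum_right cmult_scaleR linear_sum[OF linear_cconj]
        linear_scale[OF linear_cconj] b)
qed

lemma blade_cmult_nth:
  "(blade A \<odot> b) $ C = blade_sign A (sym_diff A C) * b $ sym_diff A C"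
proof -
  have eq: "sym_diff A B = C \<longleftrightarrow> B = sym_diff A C" for B by auto
  have "(blade A \<odot> b) $ C = (\<Sum>B\<in>UNIV. if B = sym_diff A C then b $ B * blade_sign A B else 0)"
    by (subst clifford_expand[of b])
      (simp add: cmult_sum_right cmult_scaleR blade_cmult_blade blade_nth eq
        if_distrib[of "\<lambda>x. _ * x"] cong: if_cong)
  then show ?thesis by simp
qed

text \<open>Left multiplication by a blade permutes the coordinates by the involution
  \<open>sym_diff A\<close>, up to signs.\<close>

lemma norm_blade_cmult: "norm (blade A \<odot> b) = norm b"
proof -
  have "(\<Sum>C\<in>UNIV. (b $ sym_diff A C)\<^sup>2) = (\<Sum>C\<in>UNIV. (b $ C)\<^sup>2)"
    by (rule sum.reindex_bij_witness[of _ "sym_diff A" "sym_diff A"]) auto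
  moreover have "((blade A \<odot> b) $ C)\<^sup>2 = (b $ sym_diff A C)\<^sup>2" for C
    using blade_sign_square[of A "sym_diff A C"]
    by (simp add: blade_cmult_nth power_mult_distrib power2_eq_square)
  ultimately show ?thesis by (simp add: norm_vec_def L2_set_def)
qed

lemma norm0_eq: "norm0 a = sqrt (2 ^ CARD('n)) * norm a" for a :: "'n::{finite,linorder} clifford"
  by (simp add: norm0_def norm_vec_def L2_set_def real_sqrt_mult)

lemma norm0_scaleR: "norm0 (c *\<^sub>R a) = \<bar>c\<bar> * norm0 a"
  by (simp add: norm0_eq)

lemma norm0_square: "(norm0 a)\<^sup>2 = 2 ^ CARD('n) * (norm a)\<^sup>2" for a :: "'n::{finite,linorder} clifford"
  by (simp add: norm0_eq power_mult_distrib)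

text \<open>Expanding a into blades bounds the product by the l^1 norm of the coordinates of a times
  the norm of b; Cauchy-Schwarz over the 2^n blades gives the constant.\<close>

lemma norm_cmult_le: "norm (a \<odot> b) \<le> sqrt (2 ^ CARD('n)) * norm a * norm b"
  for a b :: "'n::{finite,linorder} clifford"
proof -
  have "(\<Sum>A\<in>UNIV. \<bar>a $ A\<bar>)\<^sup>2 \<le> (sqrt (2 ^ CARD('n)) * norm a)\<^sup>2"
    using sum_squared_le_sum_of_squares[of "\<lambda>A. \<bar>a $ A\<bar>" UNIV]
    by (simp add: power_mult_distrib norm_vec_def L2_set_def sum_nonneg mult.commute
        card_Pow[of "UNIV :: 'n set", simplified])
  then have "(\<Sum>A\<in>UNIV. \<bar>a $ A\<bar>) \<le> sqrt (2 ^ CARD('n)) * norm a"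
    by (rule power2_le_imp_le) simp
  then have *: "(\<Sum>A\<in>UNIV. \<bar>a $ A\<bar>) * norm b \<le> sqrt (2 ^ CARD('n)) * norm a * norm b"
    by (rule mult_right_mono) simp
  have "norm (a \<odot> b) \<le> (\<Sum>A\<in>UNIV. norm ((a $ A) *\<^sub>R (blade A \<odot> b)))"
    by (subst clifford_expand[of a]) (simp only: cmult_sum_left cmult_scaleR norm_sum)
  with * show ?thesis by (simp add: norm_blade_cmult sum_distrib_right)
qed

text \<open>The normalisation of \<open>norm0\<close> absorbs exactly the constant of
  \<open>norm_cmult_le\<close>.\<close>

lemma norm0_cmult_le: "norm0 (a \<odot> b) \<le> norm0 a * norm0 b"
  for a b :: "'n::{finite,linorder} clifford"
  using mult_left_mono[OF norm_cmult_le[of a b], of "sqrt (2 ^ CARD('n))"]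
  by (simp add: norm0_eq mult_ac)

lemma cconj_nth: "cconj a $ A = a $ A * blade_sign A A"
proof -
  have "cconj a $ A = (\<Sum>B\<in>UNIV. if B = A then a $ A * blade_sign A A else 0)"
    unfolding cconj_alt by (simp add: blade_nth if_distrib[of "\<lambda>x. _ * x"] cong: if_cong)
  then show ?thesis by simp
qed

lemma norm0_cconj: "norm0 (cconj a) = norm0 a"
proof -
  have "(cconj a $ A)\<^sup>2 = (a $ A)\<^sup>2" for A
    using blade_sign_square[of A A] by (simp add: cconj_nth power_mult_distrib power2_eq_square)
  then show ?thesis by (simp add: norm0_def)
qed

text \<open>Only equal blades multiply to a multiple of the unit, and the sign of conj(e_A) cancels
  that of e_A e_A. This is the bridge from the Clifford-valued pairing to real L^2.\<close>

lemma cconj_cmult_scalar_part: "(cconj a \<odot> b) $ {} = a \<bullet> b"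
proof -
  have "(cconj a \<odot> b) $ {} = (\<Sum>A\<in>UNIV. (a $ A * blade_sign A A) * (blade_sign A A * b $ A))"
    unfolding cconj_alt by (simp add: cmult_sum_left cmult_scaleR blade_cmult_nth)
  also have "\<dots> = (\<Sum>A\<in>UNIV. (blade_sign A A * blade_sign A A) * (a $ A * b $ A))"
    by (simp only: mult_ac)
  also have "\<dots> = a \<bullet> b" by (simp only: blade_sign_square inner_vec_def) simp
  finally show ?thesis .
qed

lemmas cmult_zero = bilinear_lzero[OF bilinear_cmult] bilinear_rzero[OF bilinear_cmult]

lemma blade_inner: "blade A \<bullet> u = u $ A"
  by (simp add: blade_def inner_axis')

lemmas bounded_linear_cmult_left = linear_conv_bounded_linear[THEN iffD1, OF
    bilinear_cmult[unfolded bilinear_def, THEN conjunct2, rule_format]]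
lemmas bounded_linear_cmult_right = linear_conv_bounded_linear[THEN iffD1, OF
    bilinear_cmult[unfolded bilinear_def, THEN conjunct1, rule_format]]
lemmas bounded_linear_cconj = linear_conv_bounded_linear[THEN iffD1, OF linear_cconj]

section \<open>Smooth approximation of compactly supported functions\<close>

definition smooth :: "('a::euclidean_space \<Rightarrow> real) \<Rightarrow> bool" where
  "smooth g \<longleftrightarrow> (\<forall>k. Ck_on k UNIV g)"

lemma smooth_differentiable: "smooth g \<Longrightarrow> g differentiable (at x)"
  unfolding smooth_def by (drule spec[of _ "Suc 0"]) simp

lemma smooth_derivative: "smooth g \<Longrightarrow> v \<in> Basis \<Longrightarrow> smooth (\<lambda>x. frechet_derivative g (at x) v)"
  unfolding smooth_def using Ck_on.simps(2) by blast

lemma smooth_continuous: "smooth g \<Longrightarrow> continuous_on S g"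
  unfolding smooth_def by (meson Ck_on.simps(1) continuous_on_subset subset_UNIV)

text \<open>Coinduction for smoothness: a set of functions closed under derivatives along the basis
  consists of smooth functions. It replaces formulas for iterated derivatives; continuity at order 0
  comes from differentiability.\<close>

lemma smooth_coinduct:
  assumes "g \<in> S"
    and S: "\<And>g. g \<in> S \<Longrightarrow> \<exists>g'. (\<forall>x. (g has_derivative g' x) (at x)) \<and> (\<forall>v\<in>Basis. (\<lambda>x. g' x v) \<in> S)"
  shows "smooth g"
proof -
  have "\<forall>g\<in>S. Ck_on k UNIV g" for k
  proof (induction k)
    case 0
    then show ?case
      using S by (fastforce intro: continuous_at_imp_continuous_on has_derivative_continuous)
  next
    case (Suc k)
    show ?case
    proof
      fix g assume "g \<in> S"
      then obtain g' where g': "\<And>x. (g has_derivative g' x) (at x)" "\<And>v. v \<in> Basis \<Longrightarrow> (\<lambda>x. g' x v) \<in> S"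
        using S by blast
      then have "frechet_derivative g (at x) = g' x" for x
        by (metis frechet_derivative_at)
      then show "Ck_on (Suc k) UNIV g"
        using g' Suc by (auto simp: differentiable_def)
    qed
  qed
  then show ?thesis using assms(1) by (auto simp: smooth_def)
qed

section \<open>Bump functions and mollifiers\<close>

text \<open>For \<open>m = 0\<close> this is the classical exp(-1/t), flat at 0. The powers in the
  denominator are included so that the linear span of the family is closed under
  differentiation.\<close>

definition flat :: "nat \<Rightarrow> real \<Rightarrow> real" where
  "flat m t = (if t > 0 then exp (- (1/t)) / t ^ m else 0)"

text \<open>A single term, of order m + 2, of the series of exp(1/t) bounds it from below. Two
  orders beyond m leave the t^2 that makes the derivative at 0 vanish.\<close>

lemma flat_le:
  assumes "t > 0" shows "flat m t \<le> fact (m + 2) * t\<^sup>2"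
proof -
  have "(1/t) ^ (m+2) / fact (m+2) \<le> exp (1/t)"
  proof -
    have "(\<lambda>n. (1/t)^n /\<^sub>R fact n) sums exp (1/t)" by (rule exp_converges)
    then have "(\<Sum>n\<in>{m+2}. (1/t)^n /\<^sub>R fact n) \<le> exp (1/t)"
      using assms unfolding sums_unique[OF \<open>_ sums _\<close>]
      by (intro sum_le_suminf) (auto simp: sums_iff)
    then show ?thesis by (simp add: divide_inverse mult.commute)
  qed
  then have "1 \<le> exp (1/t) * fact (m+2) * t ^ (m+2)"
    using assms by (simp add: field_simps del: fact_Suc power_Suc)
  then have "exp (- (1/t)) \<le> fact (m+2) * t ^ (m+2)"
    by (simp add: exp_minus field_simps del: fact_Suc power_Suc)
  then show ?thesis
    using assms by (simp add: flat_def field_simps power_add power2_eq_square)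
qed

lemma flat_has_derivative:
  "(flat m has_real_derivative flat (m+2) t - m * flat (m+1) t) (at t)"
proof (cases t "0::real" rule: linorder_cases)
  case less
  have "((\<lambda>_. 0) has_real_derivative 0) (at t)" by simp
  then have "(flat m has_real_derivative 0) (at t)"
    by (rule has_field_derivative_transform_within_open[of _ _ _ "{..<0}"])
      (use less in \<open>auto simp: flat_def\<close>)
  then show ?thesis using less by (simp add: flat_def)
next
  case equal
  have "(\<lambda>h. (flat m (0 + h) - flat m 0) / h) \<midarrow>0\<rightarrow> 0"
  proof (rule tendsto_0_le[where K=1 and f="\<lambda>h. fact (m+2) * h"])
    show "((\<lambda>h::real. fact (m+2) * h) \<longlongrightarrow> 0) (at 0)"
      by (auto intro!: tendsto_eq_intros)
    have "norm ((flat m (0 + h) - flat m 0) / h) \<le> norm (fact (m+2) * h) * 1" for h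
    proof (cases "h > 0")
      case True
      then have "flat m h \<ge> 0" by (simp add: flat_def)
      with True show ?thesis
        using flat_le[OF True, of m]
        by (simp add: flat_def[of m 0] power2_eq_square field_simps del: fact_Suc)
    qed (simp add: flat_def)
    then show "\<forall>\<^sub>F h in at 0. norm ((flat m (0 + h) - flat m 0) / h) \<le> norm (fact (m+2) * h) * 1"
      by simp
  qed
  then show ?thesis using equal by (simp add: DERIV_def flat_def)
next
  case greater
  have "((\<lambda>t. exp (- (1/t)) / t ^ m) has_real_derivative flat (m+2) t - m * flat (m+1) t) (at t)"
  proof (cases m)
    case 0
    then show ?thesis using greater
      by (auto intro!: derivative_eq_intros simp: flat_def field_simps power2_eq_square)
  next
    case (Suc k)
    have "((\<lambda>t. exp (- (1/t)) / t ^ m) has_real_derivative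
       (exp (- (1/t)) * (1 / t\<^sup>2) * t ^ m - exp (- (1/t)) * (m * t ^ k)) / (t ^ m * t ^ m)) (at t)"
    proof -
      have "((\<lambda>t. exp (- (1/t))) has_real_derivative exp (- (1/t)) * (1 / t\<^sup>2)) (at t)"
        using greater by (auto intro!: derivative_eq_intros simp: power2_eq_square)
      from DERIV_divide[OF this DERIV_pow[of m t]] show ?thesis
        using greater Suc by simp
    qed
    moreover have "(exp (- (1/t)) * (1 / t\<^sup>2) * t ^ m - exp (- (1/t)) * (m * t ^ k)) / (t ^ m * t ^ m)
       = flat (m+2) t - m * flat (m+1) t"
      using greater Suc by (cases k) (simp_all add: flat_def field_simps power2_eq_square)
    ultimately show ?thesis by simp
  qed
  then show ?thesis
    by (rule has_field_derivative_transform_within_open[of _ _ _ "{0<..}"])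
      (use greater in \<open>auto simp: flat_def\<close>)
qed

text \<open>The algebra generated by the linear functionals and the radial functions
  \<open>flat m (r - x \<bullet> x)\<close>. It contains the bump supported in the ball of squared
  radius r and is closed under differentiation, as \<open>smooth_coinduct\<close> requires.\<close>

inductive_set bumps :: "real \<Rightarrow> ('a::euclidean_space \<Rightarrow> real) set" for r where
  const: "(\<lambda>x. c) \<in> bumps r"
| coord: "(\<lambda>x. x \<bullet> w) \<in> bumps r"
| add: "f \<in> bumps r \<Longrightarrow> g \<in> bumps r \<Longrightarrow> (\<lambda>x. f x + g x) \<in> bumps r"
| mult: "f \<in> bumps r \<Longrightarrow> g \<in> bumps r \<Longrightarrow> (\<lambda>x. f x * g x) \<in> bumps r"
| flat: "(\<lambda>x. flat m (r - x \<bullet> x)) \<in> bumps r"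

lemma bumps_derivative:
  assumes "g \<in> bumps r"
  shows "\<exists>g'. (\<forall>x. (g has_derivative g' x) (at x)) \<and> (\<forall>v. (\<lambda>x. g' x v) \<in> bumps r)"
  using assms
proof induction
  case (const c)
  show ?case by (rule exI[of _ "\<lambda>x v. 0"]) (auto intro: bumps.const)
next
  case (coord w)
  show ?case
    by (rule exI[of _ "\<lambda>x v. v \<bullet> w"]) (auto intro!: bumps.const derivative_eq_intros)
next
  case (add f g)
  then obtain f' g' where "\<forall>x. (f has_derivative f' x) (at x)" "\<forall>x. (g has_derivative g' x) (at x)"
    "\<forall>v. (\<lambda>x. f' x v) \<in> bumps r" "\<forall>v. (\<lambda>x. g' x v) \<in> bumps r" by blast
  then show ?case
    by (intro exI[of _ "\<lambda>x v. f' x v + g' x v"]) (auto intro!: bumps.add derivative_intros)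
next
  case (mult f g)
  then obtain f' g' where "\<forall>x. (f has_derivative f' x) (at x)" "\<forall>x. (g has_derivative g' x) (at x)"
    "\<forall>v. (\<lambda>x. f' x v) \<in> bumps r" "\<forall>v. (\<lambda>x. g' x v) \<in> bumps r" by blast
  with mult.hyps show ?case
    by (intro exI[of _ "\<lambda>x v. f x * g' x v + f' x v * g x"])
      (auto intro!: bumps.add bumps.mult derivative_intros)
next
  case (flat m)
  let ?d = "\<lambda>x v. (flat (m+2) (r - x \<bullet> x) + (- m) * flat (m+1) (r - x \<bullet> x)) * ((-2) * (x \<bullet> v))"
  have "((\<lambda>x. flat m (r - x \<bullet> x)) has_derivative ?d x) (at x)" for x :: 'a
  proof -
    have "((\<lambda>x. r - x \<bullet> x) has_derivative (\<lambda>v. (-2) * (x \<bullet> v))) (at x)"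
      by (auto intro!: derivative_eq_intros simp: inner_commute)
    from has_derivative_compose[OF this flat_has_derivative[of m, unfolded has_field_derivative_def]]
    show ?thesis by (simp add: algebra_simps)
  qed
  then show ?case
    by (intro exI[of _ ?d] conjI allI bumps.mult bumps.add bumps.const bumps.coord bumps.flat)
qed

lemma bumps_smooth: "g \<in> bumps r \<Longrightarrow> smooth g"
  by (rule smooth_coinduct[of _ "bumps r"]) (use bumps_derivative in fast)+

lemma cball_subset_cube:
  fixes d :: real shows "cball 0 d \<subseteq> cbox (- d *\<^sub>R One) (d *\<^sub>R One :: 'a::euclidean_space)"
proof
  fix x :: 'a assume "x \<in> cball 0 d"
  then have "\<bar>x \<bullet> i\<bar> \<le> d" if "i \<in> Basis" for i
    using Basis_le_norm[OF that, of x] by auto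
  then show "x \<in> cbox (- d *\<^sub>R One) (d *\<^sub>R One)"
    by (fastforce simp: mem_box)
qed

lemma mollifier_exists:
  assumes d: "d > 0"
  obtains \<rho> :: "'a::euclidean_space \<Rightarrow> real" where "smooth \<rho>" "\<And>x. \<rho> x \<ge> 0"
    "\<And>x. norm x > d \<Longrightarrow> \<rho> x = 0" "integral (cbox (- d *\<^sub>R One) (d *\<^sub>R One)) \<rho> = 1"
proof -
  define g :: "'a \<Rightarrow> real" where "g = (\<lambda>x. flat 0 (d\<^sup>2 - x \<bullet> x))"
  let ?B = "cbox (- d *\<^sub>R One) (d *\<^sub>R One) :: 'a set"
  have g: "smooth g" unfolding g_def by (rule bumps_smooth[OF bumps.flat])
  have g0: "g x \<ge> 0" for x by (simp add: g_def flat_def)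
  define I where "I = integral ?B g"
  have "g 0 \<noteq> 0" using d by (simp add: g_def flat_def)
  moreover have "0 \<in> ?B" using d by (auto simp: mem_box)
  moreover have "box (- d *\<^sub>R One) (d *\<^sub>R One :: 'a) \<noteq> {}"
    using d by (auto simp: box_ne_empty)
  \<comment> \<open>A nonnegative continuous function with zero integral over a nondegenerate box
    vanishes there, but \<open>g\<close> is positive at the origin.\<close>
  ultimately have "I \<noteq> 0"
    unfolding I_def
    using integral_cbox_eq_0_iff[of "- d *\<^sub>R One" "d *\<^sub>R One :: 'a" g] g0 smooth_continuous[OF g]
    by auto
  moreover have "I \<ge> 0"
    unfolding I_def using g0 by (intro integral_nonneg integrable_continuous smooth_continuous g)
  ultimately have I: "I > 0" by simp
  show ?thesis
  proof
    show "smooth (\<lambda>x. 1 / I * g x)"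
      unfolding g_def by (intro bumps_smooth[of _ "d\<^sup>2"] bumps.mult bumps.const bumps.flat)
    show "1 / I * g x \<ge> 0" for x using I g0 by simp
    show "1 / I * g x = 0" if "norm x > d" for x
    proof -
      have "x \<bullet> x > d\<^sup>2" using that d by (simp add: power2_norm_eq_inner[symmetric] power_strict_mono)
      then show ?thesis by (simp add: g_def flat_def)
    qed
    have "integral ?B (\<lambda>x. (1 / I) * g x) = 1 / I * I"
      unfolding I_def by (rule integral_mult_right)
    then show "integral ?B (\<lambda>x. (1 / I) * g x) = 1" using I by simp
  qed
qed

section \<open>Convolution with a mollifier\<close>

text \<open>Differentiation under the integral puts the derivative on \<open>g\<close>, which need
  only be C^1. It thus serves with the mollifier as \<open>g\<close>, giving smoothness, and with
  the approximated function as \<open>g\<close>, giving closeness of derivatives.\<close>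

lemma convolution_has_derivative:
  fixes g h :: "'a::euclidean_space \<Rightarrow> real"
  assumes h: "continuous_on UNIV h" and g: "\<And>x. g differentiable (at x)"
    and g': "\<And>v. v \<in> Basis \<Longrightarrow> continuous_on UNIV (\<lambda>x. frechet_derivative g (at x) v)"
  shows "((\<lambda>x. integral (cbox a b) (\<lambda>y. h y * g (x - y))) has_derivative
     (\<lambda>v. integral (cbox a b) (\<lambda>y. h y * frechet_derivative g (at (x - y)) v))) (at x)"
proof -
  define G where "G = (\<lambda>z. Blinfun (frechet_derivative g (at z)))"
  have bl: "bounded_linear (frechet_derivative g (at z))" for z
    using g by (meson frechet_derivative_works has_derivative_bounded_linear)
  have G: "blinfun_apply (G z) = frechet_derivative g (at z)" for z
    unfolding G_def by (rule bounded_linear_Blinfun_apply[OF bl])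
  \<comment> \<open>The Leibniz rule asks for a derivative continuous in operator norm; in finite
    dimension continuity along each basis vector is enough.\<close>
  have contG: "continuous_on UNIV G"
    by (rule continuous_on_blinfun_componentwise) (auto simp: G g')
  have contg: "continuous_on UNIV g"
    using g by (intro continuous_at_imp_continuous_on ballI differentiable_imp_continuous_within)
  have contF: "continuous_on S (\<lambda>(x, t). h t *\<^sub>R G (x - t))" for S
    unfolding split_beta
    by (intro continuous_intros continuous_on_compose2[OF contG] continuous_on_compose2[OF h]) auto
  have "((\<lambda>x. integral (cbox a b) (\<lambda>y. h y * g (x - y))) has_derivative
      blinfun_apply (integral (cbox a b) (\<lambda>y. h y *\<^sub>R G (x - y)))) (at x within UNIV)"
  proof (rule leibniz_rule)
    fix x t
    have "(g has_derivative blinfun_apply (G (x - t))) (at (x - t))"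
      using g G frechet_derivative_works by metis
    then have "((\<lambda>x. g (x - t)) has_derivative blinfun_apply (G (x - t))) (at x)"
      by (rule has_derivative_compose[rotated]) (auto intro!: derivative_eq_intros)
    then show "((\<lambda>x. h t * g (x - t)) has_derivative blinfun_apply (h t *\<^sub>R G (x - t))) (at x within UNIV)"
      by (auto intro!: derivative_eq_intros simp: blinfun.scaleR_left)
  next
    fix x
    show "(\<lambda>y. h y * g (x - y)) integrable_on cbox a b"
      by (intro integrable_continuous continuous_intros continuous_on_compose2[OF contg]
          continuous_on_compose2[OF h]) auto
  qed (auto intro: contF)
  moreover have "(\<lambda>y. h y *\<^sub>R G (x - y)) integrable_on cbox a b"
    by (intro integrable_continuous continuous_intros continuous_on_compose2[OF contG]
        continuous_on_compose2[OF h]) auto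
  from this have "blinfun_apply (integral (cbox a b) (\<lambda>y. h y *\<^sub>R G (x - y))) v =
     integral (cbox a b) (\<lambda>y. h y * frechet_derivative g (at (x - y)) v)" for v
    by (subst blinfun_apply_integral) (auto simp: blinfun.scaleR_left G)
  then have "blinfun_apply (integral (cbox a b) (\<lambda>y. h y *\<^sub>R G (x - y))) =
     (\<lambda>v. integral (cbox a b) (\<lambda>y. h y * frechet_derivative g (at (x - y)) v))"
    by (rule ext)
  ultimately show ?thesis by simp
qed

text \<open>The convolutions of a fixed \<open>h\<close> with all smooth functions form a set closed
  under differentiation.\<close>

lemma convolution_smooth:
  assumes "continuous_on UNIV h" "smooth g"
  shows "smooth (\<lambda>x. integral (cbox a b) (\<lambda>y. h y * g (x - y)))"
proof (rule smooth_coinduct)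
  let ?S = "{\<lambda>x. integral (cbox a b) (\<lambda>y. h y * g (x - y)) | g. smooth g}"
  show "(\<lambda>x. integral (cbox a b) (\<lambda>y. h y * g (x - y))) \<in> ?S" using assms(2) by blast
  fix f assume "f \<in> ?S"
  then obtain g where f: "f = (\<lambda>x. integral (cbox a b) (\<lambda>y. h y * g (x - y)))" and g: "smooth g"
    by auto
  let ?f' = "\<lambda>x v. integral (cbox a b) (\<lambda>y. h y * frechet_derivative g (at (x - y)) v)"
  have "(f has_derivative ?f' x) (at x)" for x
    unfolding f
    by (rule convolution_has_derivative[OF assms(1) smooth_differentiable[OF g]
          smooth_continuous[OF smooth_derivative[OF g]]])
  moreover have "(\<lambda>x. ?f' x v) \<in> ?S" if "v \<in> Basis" for v
    by (rule CollectI, rule exI[of _ "\<lambda>x. frechet_derivative g (at x) v"])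
      (simp add: smooth_derivative[OF g that])
  ultimately show "\<exists>g'. (\<forall>x. (f has_derivative g' x) (at x)) \<and> (\<forall>v\<in>Basis. (\<lambda>x. g' x v) \<in> ?S)"
    by (intro exI[of _ ?f'] conjI allI ballI)
qed

text \<open>Substitute z = x - y; both integrands vanish outside their boxes, so both sides are
  integrals over the whole space.\<close>

lemma convolution_commute:
  fixes h g :: "'a::euclidean_space \<Rightarrow> real"
  assumes h: "continuous_on UNIV h" "\<And>x. x \<notin> cbox a b \<Longrightarrow> h x = 0"
    and g: "continuous_on UNIV g" "\<And>x. x \<notin> cbox c d \<Longrightarrow> g x = 0"
  shows "integral (cbox a b) (\<lambda>y. h y * g (x - y)) = integral (cbox c d) (\<lambda>z. g z * h (x - z))"
proof -
  let ?f = "\<lambda>z. g z * h (x - z)"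
  let ?i = "integral (cbox c d) ?f"
  have "(?f has_integral ?i) (cbox c d)"
    by (intro integrable_integral integrable_continuous continuous_intros
        continuous_on_compose2[OF h(1)] continuous_on_compose2[OF g(1)]) auto
  from has_integral_affinity[OF this, of "-1" x]
  have "((\<lambda>y. h y * g (x - y)) has_integral ?i) ((\<lambda>z. x - z) ` cbox c d)"
    by (simp add: mult.commute)
  then have "((\<lambda>y. h y * g (x - y)) has_integral ?i) UNIV"
  proof (rule has_integral_on_superset)
    fix y assume "y \<notin> (\<lambda>z. x - z) ` cbox c d"
    then have "x - y \<notin> cbox c d" by (auto simp: image_iff dest: bspec[of _ _ "x - y"])
    then show "h y * g (x - y) = 0" using g(2) by simp
  qed simp
  moreover have "((\<lambda>y. h y * g (x - y)) has_integral integral (cbox a b) (\<lambda>y. h y * g (x - y))) (cbox a b)"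
    by (intro integrable_integral integrable_continuous continuous_intros
        continuous_on_compose2[OF h(1)] continuous_on_compose2[OF g(1)]) auto
  then have "((\<lambda>y. h y * g (x - y)) has_integral integral (cbox a b) (\<lambda>y. h y * g (x - y))) UNIV"
    by (rule has_integral_on_superset) (use h(2) in auto)
  ultimately show ?thesis by (metis has_integral_unique)
qed

text \<open>Heine-Cantor is applied on the closed 1-neighbourhood of K: of two points closer than 1,
  either one lies in K and both lie in that neighbourhood, or both values are 0.\<close>

lemma uniformly_continuous_compact_support:
  fixes h :: "'a::euclidean_space \<Rightarrow> real"
  assumes h: "continuous_on UNIV h" and K: "compact K" and K0: "\<And>x. x \<notin> K \<Longrightarrow> h x = 0"
  shows "uniformly_continuous_on UNIV h"
  unfolding uniformly_continuous_on_def
proof (intro allI impI)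
  fix e :: real assume "e > 0"
  define S where "S = {x + y |x y. x \<in> K \<and> y \<in> cball 0 (1::real)}"
  have "compact S" unfolding S_def by (intro compact_sums K compact_cball)
  then have "uniformly_continuous_on S h"
    by (rule compact_uniformly_continuous[rotated]) (rule continuous_on_subset[OF h], simp)
  then obtain d where d: "d > 0" "\<And>x y. x \<in> S \<Longrightarrow> y \<in> S \<Longrightarrow> dist y x < d \<Longrightarrow> dist (h y) (h x) < e"
    unfolding uniformly_continuous_on_def using \<open>e > 0\<close> by metis
  have S: "y \<in> S" if "x \<in> K" "dist y x < 1" for x y
    unfolding S_def using that
    by (intro CollectI, rule_tac exI[of _ x], rule_tac exI[of _ "y - x"])
      (auto simp: dist_norm norm_minus_commute)
  show "\<exists>d>0. \<forall>x\<in>UNIV. \<forall>y\<in>UNIV. dist y x < d \<longrightarrow> dist (h y) (h x) < e"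
  proof (intro exI[of _ "min d 1"] conjI ballI impI)
    fix x y :: 'a assume xy: "dist y x < min d 1"
    show "dist (h y) (h x) < e"
    proof (cases "x \<in> K \<or> y \<in> K")
      case True
      then have "x \<in> S" "y \<in> S" using S[of x x] S[of y y] S[of x y] S[of y x] xy by (auto simp: dist_commute)
      then show ?thesis using d xy by auto
    qed (use K0 \<open>e > 0\<close> in auto)
  qed (use d in auto)
qed

lemma frechet_derivative_zero_outside:
  assumes "closed K" "\<And>x. x \<notin> K \<Longrightarrow> h x = 0" "x \<notin> K"
  shows "frechet_derivative h (at x) v = 0"
proof -
  have "((\<lambda>_. 0) has_derivative (\<lambda>_. 0)) (at x)" by simp
  then have "(h has_derivative (\<lambda>_. 0)) (at x)"
    by (rule has_derivative_transform_within_open[of _ _ _ _ "- K"]) (use assms in auto)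
  then show ?thesis by (metis frechet_derivative_at)
qed

text \<open>With total mass 1, \<open>h x\<close> is the \<open>\<rho>\<close>-average of the
  constant \<open>h x\<close>, so the error is an average of differences
  \<open>h (x - z) - h x\<close>.\<close>

lemma mollified_close:
  fixes h \<rho> :: "'a::euclidean_space \<Rightarrow> real"
  assumes h: "continuous_on UNIV h" and \<rho>: "continuous_on UNIV \<rho>" "\<And>x. \<rho> x \<ge> 0" "integral (cbox a b) \<rho> = 1"
    and close: "\<And>z. \<rho> z \<noteq> 0 \<Longrightarrow> \<bar>h (x - z) - h x\<bar> \<le> e"
  shows "\<bar>integral (cbox a b) (\<lambda>z. \<rho> z * h (x - z)) - h x\<bar> \<le> e"
proof -
  have i: "(\<lambda>z. \<rho> z * h (x - z)) integrable_on cbox a b" "\<rho> integrable_on cbox a b"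
    by (intro integrable_continuous continuous_intros continuous_on_compose2[OF h]
        continuous_on_compose2[OF \<rho>(1)]; auto)+
  then have "integral (cbox a b) (\<lambda>z. \<rho> z * h (x - z)) - h x =
      integral (cbox a b) (\<lambda>z. \<rho> z * h (x - z)) - integral (cbox a b) (\<lambda>z. \<rho> z * h x)"
    using \<rho>(3) by simp
  also have "\<dots> = integral (cbox a b) (\<lambda>z. \<rho> z * h (x - z) - \<rho> z * h x)"
    using i by (intro integral_diff[symmetric] integrable_on_mult_left)
  also have "norm \<dots> \<le> integral (cbox a b) (\<lambda>z. \<rho> z * e)"
  proof (rule integral_norm_bound_integral)
    show "norm (\<rho> z * h (x - z) - \<rho> z * h x) \<le> \<rho> z * e" for z
      using close[of z] \<rho>(2)[of z]
      by (cases "\<rho> z = 0") (auto simp: abs_mult simp flip: right_diff_distrib intro: mult_left_mono)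
  qed (use i in \<open>auto intro!: integrable_diff integrable_on_mult_left\<close>)
  also have "\<dots> = e" using \<rho>(3) by simp
  finally show ?thesis by simp
qed

lemma smooth_approximation:
  fixes b :: "'a::euclidean_space \<Rightarrow> real"
  assumes b: "Ck_on 1 UNIV b" and K: "compact K" "\<And>x. x \<notin> K \<Longrightarrow> b x = 0" and e: "e > 0"
  obtains g where "smooth g" "\<And>x. g x \<noteq> 0 \<Longrightarrow> \<exists>y\<in>K. dist y x \<le> e"
    "\<And>x. \<bar>g x - b x\<bar> \<le> e"
    "\<And>x v. v \<in> Basis \<Longrightarrow> \<bar>frechet_derivative g (at x) v - frechet_derivative b (at x) v\<bar> \<le> e"
proof -
  have bd: "b differentiable (at x)" for x
    using b by auto
  have bd': "continuous_on UNIV (\<lambda>x. frechet_derivative b (at x) v)" if "v \<in> Basis" for v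
    using b that by auto
  have bc: "continuous_on UNIV b"
    using bd by (intro continuous_at_imp_continuous_on ballI differentiable_imp_continuous_within)
  have uc: "\<exists>d>0. \<forall>x z. norm z \<le> d \<longrightarrow> \<bar>h (x - z) - h x\<bar> \<le> e"
    if hc: "continuous_on UNIV h" and h0: "\<And>x. x \<notin> K \<Longrightarrow> h x = 0" for h :: "'a \<Rightarrow> real"
  proof -
    obtain d where d: "d > 0" "\<And>x y. dist y x < d \<Longrightarrow> dist (h y) (h x) < e"
      using uniformly_continuous_compact_support[OF hc K(1) h0] e
      unfolding uniformly_continuous_on_def by auto
    show ?thesis
    proof (intro exI[of _ "d/2"] conjI allI impI)
      fix x z :: 'a assume "norm z \<le> d/2"
      then have "dist (x - z) x < d" using d by (simp add: dist_norm)
      from d(2)[OF this] show "\<bar>h (x - z) - h x\<bar> \<le> e" by (simp add: dist_real_def)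
    qed (use d in auto)
  qed
  obtain d0 where d0: "d0 > 0" "\<And>x z. norm z \<le> d0 \<Longrightarrow> \<bar>b (x - z) - b x\<bar> \<le> e"
    using uc[OF bc] K by blast
  have "\<forall>v\<in>Basis. \<exists>d>0. \<forall>x z. norm z \<le> d \<longrightarrow>
      \<bar>frechet_derivative b (at (x - z)) v - frechet_derivative b (at x) v\<bar> \<le> e"
  proof
    fix v :: 'a assume "v \<in> Basis"
    then show "\<exists>d>0. \<forall>x z. norm z \<le> d \<longrightarrow>
      \<bar>frechet_derivative b (at (x - z)) v - frechet_derivative b (at x) v\<bar> \<le> e"
      by (intro uc bd' frechet_derivative_zero_outside[OF compact_imp_closed[OF K(1)]] K(2))
  qed
  then obtain D where D: "\<And>v. v \<in> Basis \<Longrightarrow> D v > 0" "\<And>v x z. v \<in> Basis \<Longrightarrow> norm z \<le> D v \<Longrightarrow>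
      \<bar>frechet_derivative b (at (x - z)) v - frechet_derivative b (at x) v\<bar> \<le> e"
    by metis
  \<comment> \<open>The radius lies below the moduli of continuity of \<open>b\<close> and of each
    of its basis derivatives, and below \<open>e\<close>, so that the support spreads by at most
    \<open>e\<close>.\<close>
  define d where "d = Min ({d0, e} \<union> D ` Basis)"
  have d: "d > 0" using d0 D e by (auto simp: d_def)
  have le: "d \<le> d0" "d \<le> e" "\<And>v. v \<in> Basis \<Longrightarrow> d \<le> D v"
    unfolding d_def by (rule Min_le; simp)+
  obtain \<rho> :: "'a \<Rightarrow> real" where \<rho>: "smooth \<rho>" "\<And>x. \<rho> x \<ge> 0"
    "\<And>x. norm x > d \<Longrightarrow> \<rho> x = 0" "integral (cbox (- d *\<^sub>R One) (d *\<^sub>R One)) \<rho> = 1"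
    using mollifier_exists[OF d] by metis
  have \<rho>d: "norm z \<le> d" if "\<rho> z \<noteq> 0" for z using that \<rho>(3)[of z] by force
  have \<rho>c: "continuous_on UNIV \<rho>" using \<rho>(1) by (rule smooth_continuous)
  have "bounded K" using K(1) by (rule compact_imp_bounded)
  from bounded_subset_cbox_symmetric[OF this] obtain a where a: "K \<subseteq> cbox (- a) a" by blast
  let ?B = "cbox (- d *\<^sub>R One) (d *\<^sub>R One) :: 'a set"
  define g where "g = (\<lambda>x. integral (cbox (- a) a) (\<lambda>y. b y * \<rho> (x - y)))"
  \<comment> \<open>The defining form, with \<open>\<rho>\<close> translated, gives smoothness; this
    form, with \<open>b\<close> translated, shows that the derivatives of \<open>g\<close> are
    mollified derivatives of \<open>b\<close>.\<close>
  have g2: "g = (\<lambda>x. integral ?B (\<lambda>z. \<rho> z * b (x - z)))"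
    unfolding g_def
    by (intro ext convolution_commute bc \<rho>c)
      (use a K(2) \<rho>d cball_subset_cube[of d] in \<open>auto simp: subset_iff\<close>)
  have gd: "frechet_derivative g (at x) = (\<lambda>v. integral ?B (\<lambda>z. \<rho> z * frechet_derivative b (at (x - z)) v))" for x
    unfolding g2 by (intro frechet_derivative_at[symmetric] convolution_has_derivative \<rho>c bd bd')
  show ?thesis
  proof
    show "smooth g" unfolding g_def by (intro convolution_smooth bc \<rho>)
    show "\<bar>g x - b x\<bar> \<le> e" for x
      unfolding g2 using \<rho>d le by (intro mollified_close bc \<rho>c \<rho> d0(2)) force
    show "\<bar>frechet_derivative g (at x) v - frechet_derivative b (at x) v\<bar> \<le> e" if "v \<in> Basis" for x v
      unfolding gd using \<rho>d le(3)[OF that]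
      by (intro mollified_close \<rho>c \<rho> D(2)[OF that] bd'[OF that]) force
    show "\<exists>y\<in>K. dist y x \<le> e" if "g x \<noteq> 0" for x
    proof (rule ccontr)
      assume "\<not> ?thesis"
      then have "b (x - z) = 0" if "norm z \<le> d" for z
        using K(2)[of "x - z"] that le(2) by (force simp: dist_norm)
      then have "(\<lambda>z. \<rho> z * b (x - z)) = (\<lambda>_. 0)" using \<rho>d by fastforce
      then show False using that by (simp add: g2)
    qed
  qed
qed

section \<open>The Riesz representation theorem in $L^2$\<close>

definition square_integrable :: "'a measure \<Rightarrow> ('a \<Rightarrow> 'b::euclidean_space) \<Rightarrow> bool" where
  "square_integrable M v \<longleftrightarrow> v \<in> borel_measurable M \<and> integrable M (\<lambda>x. (norm (v x))\<^sup>2)"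

lemma square_integrable_inner:
  assumes "square_integrable M v" "square_integrable M w"
  shows "integrable M (\<lambda>x. v x \<bullet> w x)"
proof (rule Bochner_Integration.integrable_bound)
  show "integrable M (\<lambda>x. (norm (v x))\<^sup>2 + (norm (w x))\<^sup>2)"
    using assms by (auto simp: square_integrable_def)
  have "\<bar>v x \<bullet> w x\<bar> \<le> (norm (v x))\<^sup>2 + (norm (w x))\<^sup>2" for x
    using Cauchy_Schwarz_ineq2[of "v x" "w x"] sum_squares_bound[of "norm (v x)" "norm (w x)"]
      mult_nonneg_nonneg[OF norm_ge_zero[of "v x"] norm_ge_zero[of "w x"]]
    by linarith
  then show "AE x in M. norm (v x \<bullet> w x) \<le> norm ((norm (v x))\<^sup>2 + (norm (w x))\<^sup>2)"
    by auto
qed (use assms in \<open>auto simp: square_integrable_def\<close>)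

lemma norm_add_scaleR_sq:
  "(norm (a + s *\<^sub>R b))\<^sup>2 = (norm a)\<^sup>2 + 2 * s * (a \<bullet> b) + s\<^sup>2 * (norm b)\<^sup>2"
  for a b :: "'b::euclidean_space"
  unfolding power2_norm_eq_inner
  by (simp add: inner_add_left inner_add_right inner_commute algebra_simps power2_eq_square)

lemma
  assumes "square_integrable M v" "square_integrable M w"
  shows square_integrable_add_scaleR: "square_integrable M (\<lambda>x. v x + s *\<^sub>R w x)"
    and integral_norm_add_scaleR: "(\<integral>x. (norm (v x + s *\<^sub>R w x))\<^sup>2 \<partial>M) =
      (\<integral>x. (norm (v x))\<^sup>2 \<partial>M) + 2 * s * (\<integral>x. v x \<bullet> w x \<partial>M) + s\<^sup>2 * (\<integral>x. (norm (w x))\<^sup>2 \<partial>M)"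
  using assms square_integrable_inner[OF assms]
  unfolding norm_add_scaleR_sq square_integrable_def by auto

lemma quadratic_nonneg_discriminant:
  fixes A B C :: real
  assumes "\<And>s. A + 2 * s * B + s\<^sup>2 * C \<ge> 0" and "C \<ge> 0"
  shows "B\<^sup>2 \<le> A * C"
proof (cases "C = 0")
  case True
  have "B = 0"
  proof (rule ccontr)
    assume "B \<noteq> 0"
    \<comment> \<open>At this \<open>s\<close> the expression A + 2sB equals -1.\<close>
    then show False using assms(1)[of "- (A + 1) / (2 * B)"] True by (simp add: field_simps)
  qed
  then show ?thesis using True by simp
next
  case False
  then have "C > 0" using assms(2) by simp
  \<comment> \<open>\<open>- B / C\<close> minimises the quadratic.\<close>
  then show ?thesis using assms(1)[of "- B / C"]
    by (simp add: field_simps power2_eq_square)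
qed

lemma square_integrable_Cauchy_Schwarz:
  assumes "square_integrable M v" "square_integrable M w"
  shows "(\<integral>x. v x \<bullet> w x \<partial>M)\<^sup>2 \<le> (\<integral>x. (norm (v x))\<^sup>2 \<partial>M) * (\<integral>x. (norm (w x))\<^sup>2 \<partial>M)"
proof (rule quadratic_nonneg_discriminant)
  fix s
  show "(\<integral>x. (norm (v x))\<^sup>2 \<partial>M) + 2 * s * (\<integral>x. v x \<bullet> w x \<partial>M) + s\<^sup>2 * (\<integral>x. (norm (w x))\<^sup>2 \<partial>M) \<ge> 0"
    unfolding integral_norm_add_scaleR[OF assms, symmetric] by simp
qed simp

text \<open>Riesz-Fischer for a geometrically fast Cauchy sequence. Squared increments of size 4^-n
  stay summable after weighting by 2^n, which forces convergence almost everywhere; Fatou's lemma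
  then carries the Cauchy bound to the limit.\<close>

lemma square_integrable_complete:
  fixes v :: "nat \<Rightarrow> 'a \<Rightarrow> 'b::euclidean_space"
  assumes v: "\<And>n. square_integrable M (v n)"
    and cauchy: "\<And>n m. n \<le> m \<Longrightarrow> (\<integral>x. (norm (v m x - v n x))\<^sup>2 \<partial>M) \<le> C * (1/4) ^ n"
  obtains u where "square_integrable M u" "\<And>n. (\<integral>x. (norm (u x - v n x))\<^sup>2 \<partial>M) \<le> C * (1/4) ^ n"
proof -
  have [measurable]: "v n \<in> borel_measurable M" for n using v by (simp add: square_integrable_def)
  have sub: "integrable M (\<lambda>x. (norm (v m x - v n x))\<^sup>2)" for m n
    using square_integrable_add_scaleR[OF v[of m] v[of n], of "-1"] by (simp add: square_integrable_def)
  have "C \<ge> 0" using cauchy[of 0 0] by simp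
  have nn: "(\<integral>\<^sup>+x. ennreal ((norm (v m x - v n x))\<^sup>2) \<partial>M) \<le> ennreal (C * (1/4) ^ n)" if "n \<le> m" for m n
    using sub cauchy[OF that] by (subst nn_integral_eq_integral) (auto intro!: ennreal_leI)
  define d where "d = (\<lambda>n x. 2 ^ n * (norm (v (Suc n) x - v n x))\<^sup>2)"
  have "(\<integral>\<^sup>+x. (\<Sum>n. ennreal (d n x)) \<partial>M) = (\<Sum>n. \<integral>\<^sup>+x. ennreal (d n x) \<partial>M)"
    unfolding d_def by (intro nn_integral_suminf) auto
  also have "\<dots> \<le> (\<Sum>n. ennreal (C * (1/2) ^ n))"
  proof (intro suminf_le summableI)
    fix n
    have "(\<integral>\<^sup>+x. ennreal (d n x) \<partial>M) = ennreal (2 ^ n) * (\<integral>\<^sup>+x. ennreal ((norm (v (Suc n) x - v n x))\<^sup>2) \<partial>M)"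
      unfolding d_def by (subst nn_integral_cmult[symmetric]) (auto simp: ennreal_mult)
    also have "\<dots> \<le> ennreal (2 ^ n) * ennreal (C * (1/4) ^ n)"
      by (intro mult_left_mono nn) auto
    also have "\<dots> = ennreal (C * (1/2) ^ n)"
      using \<open>C \<ge> 0\<close> by (subst ennreal_mult[symmetric])
        (auto simp: power_mult_distrib[symmetric] mult.left_commute)
    finally show "(\<integral>\<^sup>+x. ennreal (d n x) \<partial>M) \<le> ennreal (C * (1/2) ^ n)" .
  qed
  also have "\<dots> = ennreal (\<Sum>n. C * (1/2) ^ n)"
    using \<open>C \<ge> 0\<close> by (intro suminf_ennreal2) (auto intro!: summable_mult summable_geometric)
  also have "\<dots> < \<infinity>" by simp
  finally have "AE x in M. (\<Sum>n. ennreal (d n x)) \<noteq> \<infinity>"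
    by (intro nn_integral_noteq_infinite) (auto simp: d_def)
  then have conv: "AE x in M. (\<lambda>n. v n x) \<longlonglongrightarrow> lim (\<lambda>n. v n x)"
  proof eventually_elim
    case (elim x)
    have "summable (\<lambda>n. d n x)"
      using elim by (intro summable_suminf_not_top) (auto simp: d_def)
    then have "summable (\<lambda>n. (1/2) ^ n + d n x)"
      by (intro summable_add) (auto intro!: summable_geometric)
    moreover have "norm (v (Suc n) x - v n x) \<le> (1/2) ^ n + d n x" for n
    proof -
      \<comment> \<open>Arithmetic-geometric mean: a summable bound on 2^n times the squared
        increment also bounds the increment itself by a summable sequence.\<close>
      have "0 \<le> (1 - 2 ^ n * norm (v (Suc n) x - v n x))\<^sup>2 / 2 ^ n" by simp
      also have "\<dots> = (1/2) ^ n + d n x - 2 * norm (v (Suc n) x - v n x)"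
        unfolding d_def by (simp add: field_simps power2_eq_square)
      finally show ?thesis using norm_ge_zero[of "v (Suc n) x - v n x"] by linarith
    qed
    ultimately have "summable (\<lambda>n. v (Suc n) x - v n x)"
      by (rule summable_comparison_test'[where N=0])
    then have "convergent (\<lambda>n. \<Sum>k<n. v (Suc k) x - v k x)"
      by (simp add: summable_iff_convergent)
    then have "convergent (\<lambda>n. v n x - v 0 x)"
      unfolding sum_lessThan_telescope[of "\<lambda>k. v k x"] .
    then have "convergent (\<lambda>n. v n x)" by (simp add: convergent_diff_const_right_iff)
    then show ?case by (simp add: convergent_LIMSEQ_iff)
  qed
  \<comment> \<open>On the null set without convergence \<open>lim\<close> has an arbitrary value,
    which affects neither the measurability shown next nor any integral.\<close>
  define u where "u = (\<lambda>x. lim (\<lambda>n. v n x))"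
  have [measurable]: "u \<in> borel_measurable M"
    unfolding u_def by (rule borel_measurable_lim_metric) simp
  have le: "(\<integral>\<^sup>+x. ennreal ((norm (u x - v n x))\<^sup>2) \<partial>M) \<le> ennreal (C * (1/4) ^ n)" for n
  proof -
    have "(\<integral>\<^sup>+x. ennreal ((norm (u x - v n x))\<^sup>2) \<partial>M) \<le>
        (\<integral>\<^sup>+x. liminf (\<lambda>m. ennreal ((norm (v m x - v n x))\<^sup>2)) \<partial>M)"
    proof (rule nn_integral_mono_AE)
      show "AE x in M. ennreal ((norm (u x - v n x))\<^sup>2) \<le> liminf (\<lambda>m. ennreal ((norm (v m x - v n x))\<^sup>2))"
        using conv
      proof eventually_elim
        case (elim x)
        then have "(\<lambda>m. ennreal ((norm (v m x - v n x))\<^sup>2)) \<longlonglongrightarrow> ennreal ((norm (u x - v n x))\<^sup>2)"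
          unfolding u_def by (intro tendsto_intros)
        from lim_imp_Liminf[OF sequentially_bot this] show ?case by simp
      qed
    qed
    also have "\<dots> \<le> liminf (\<lambda>m. \<integral>\<^sup>+x. ennreal ((norm (v m x - v n x))\<^sup>2) \<partial>M)"
      by (rule nn_integral_liminf) simp
    also have "\<dots> \<le> ennreal (C * (1/4) ^ n)"
      using nn by (intro Liminf_le) (auto simp: eventually_sequentially)
    finally show ?thesis .
  qed
  have ui: "integrable M (\<lambda>x. (norm (u x - v n x))\<^sup>2)" for n
    by (intro integrableI_nonneg) (auto intro: le_less_trans[OF le])
  then have "square_integrable M (\<lambda>x. u x - v 0 x)" by (simp add: square_integrable_def)
  from square_integrable_add_scaleR[OF this v[of 0], of 1] have "square_integrable M u" by simp
  moreover have "(\<integral>x. (norm (u x - v n x))\<^sup>2 \<partial>M) \<le> C * (1/4) ^ n" for n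
    using le[of n] ui[of n] \<open>C \<ge> 0\<close> by (simp add: nn_integral_eq_integral)
  ultimately show ?thesis by (rule that)
qed

text \<open>
  The functional is given by its graph \<open>G\<close>, so that it need not be single-valued on functions
  that agree almost everywhere.  The minimum of \<open>\<parallel>v\<parallel>\<^sup>2 - 2r\<close> over \<open>G\<close> is
  attained in the limit at the representing function.
\<close>

lemma Riesz_representation_graph:
  fixes G :: "(('a \<Rightarrow> 'b::euclidean_space) \<times> real) set"
  assumes sq: "\<And>v r. (v, r) \<in> G \<Longrightarrow> square_integrable M v"
    and bound: "\<And>v r. (v, r) \<in> G \<Longrightarrow> r\<^sup>2 \<le> C * (\<integral>x. (norm (v x))\<^sup>2 \<partial>M)"
    and lin: "\<And>v r w q s. (v, r) \<in> G \<Longrightarrow> (w, q) \<in> G \<Longrightarrow> (\<lambda>x. v x + s *\<^sub>R w x, r + s * q) \<in> G"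
    and ne: "G \<noteq> {}" and "C \<ge> 0"
  obtains u where "square_integrable M u" "(\<integral>x. (norm (u x))\<^sup>2 \<partial>M) \<le> C"
    "\<And>v r. (v, r) \<in> G \<Longrightarrow> (\<integral>x. u x \<bullet> v x \<partial>M) = r"
proof -
  define N where "N v = (\<integral>x. (norm (v x))\<^sup>2 \<partial>M)" for v :: "'a \<Rightarrow> 'b"
  define B where "B v w = (\<integral>x. v x \<bullet> w x \<partial>M)" for v w :: "'a \<Rightarrow> 'b"
  have N0: "N v \<ge> 0" for v by (simp add: N_def)
  have N_add: "N (\<lambda>x. v x + s *\<^sub>R w x) = N v + 2 * s * B v w + s\<^sup>2 * N w"
    if "square_integrable M v" "square_integrable M w" for v w s
    unfolding N_def B_def using that by (rule integral_norm_add_scaleR)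
  have CS: "(B v w)\<^sup>2 \<le> N v * N w" if "square_integrable M v" "square_integrable M w" for v w
    unfolding N_def B_def using that by (rule square_integrable_Cauchy_Schwarz)
  have N_diff: "N (\<lambda>x. v x - w x) = N v - 2 * B v w + N w"
    if "square_integrable M v" "square_integrable M w" for v w
    using N_add[OF that, of "-1"] by simp
  define Q where "Q = (\<lambda>p. N (fst p) - 2 * snd p)"
  \<comment> \<open>The bound r^2 <= C N(v) and the arithmetic-geometric mean give 2r <= C + N(v),
    so the infimum below is finite.\<close>
  have Q_ge: "Q p \<ge> - C" if "p \<in> G" for p
  proof -
    obtain v r where p: "p = (v, r)" by (cases p)
    have "r\<^sup>2 \<le> C * N v" using bound[of v r] that by (simp add: p N_def)
    moreover have "(C + N v)\<^sup>2 = (C - N v)\<^sup>2 + 4 * (C * N v)"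
      by (simp add: power2_eq_square algebra_simps)
    ultimately have "4 * r\<^sup>2 \<le> (C + N v)\<^sup>2"
      using zero_le_power2[of "C - N v"] by linarith
    then have "(2 * r)\<^sup>2 \<le> (C + N v)\<^sup>2" by (simp add: power_mult_distrib)
    then have "2 * r \<le> C + N v"
      by (rule power2_le_imp_le) (use \<open>C \<ge> 0\<close> N0[of v] in linarith)
    then show ?thesis by (simp add: Q_def p)
  qed
  define m where "m = Inf (Q ` G)"
  have bdd: "bdd_below (Q ` G)" using Q_ge by (intro bdd_belowI2)
  have m: "m \<le> Q p" if "p \<in> G" for p
    unfolding m_def using bdd that by (intro cInf_lower) auto
  have "\<exists>p\<in>G. Q p < m + (1/4) ^ n" for n
    using cInf_lessD[of "Q ` G" "m + (1/4) ^ n"] ne by (auto simp: m_def)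
  then obtain p where p: "\<And>n. p n \<in> G" "\<And>n. Q (p n) < m + (1/4) ^ n" by metis
  define v r where "v = (\<lambda>n. fst (p n))" and "r = (\<lambda>n. snd (p n))"
  have vr: "(v n, r n) \<in> G" for n using p by (simp add: v_def r_def)
  have Qvr: "N (v n) - 2 * r n < m + (1/4) ^ n" for n using p(2)[of n] by (simp add: Q_def v_def r_def)
  note sqv = sq[OF vr]
  \<comment> \<open>Parallelogram argument at the midpoint: its value is (Q_n + Q_k)/2 - N(v_k -
    v_n)/4 and is at least \<open>m\<close>, while Q_n and Q_k exceed \<open>m\<close> by less than
    4^-n and 4^-k. This is the source of the factor 4.\<close>
  have cauchy: "N (\<lambda>x. v k x - v n x) \<le> 4 * (1/4) ^ n" if "n \<le> k" for n k
  proof -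
    have diff: "(\<lambda>x. v k x + (-1) *\<^sub>R v n x, r k + (-1) * r n) \<in> G" by (intro lin vr)
    then have "(\<lambda>x. v n x + (1/2) *\<^sub>R (v k x + (-1) *\<^sub>R v n x), r n + (1/2) * (r k + (-1) * r n)) \<in> G"
      by (rule lin[OF vr])
    from m[OF this] have "m \<le> N (v n) + B (v n) (\<lambda>x. v k x - v n x) + (1/4) * N (\<lambda>x. v k x - v n x) - r n - r k"
      using N_add[OF sqv sq[OF diff], of n "1/2"]
      by (simp add: Q_def power2_eq_square algebra_simps diff_divide_distrib)
    moreover have "N (v k) = N (v n) + 2 * B (v n) (\<lambda>x. v k x - v n x) + N (\<lambda>x. v k x - v n x)"
      using N_add[OF sqv sq[OF diff], of n 1] by simp
    moreover have "(1/4) ^ k \<le> ((1/4) ^ n :: real)" using that by (intro power_decreasing) auto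
    ultimately show ?thesis using Qvr[of n] Qvr[of k] by linarith
  qed
  obtain u where u: "square_integrable M u" and conv: "\<And>n. N (\<lambda>x. u x - v n x) \<le> 4 * (1/4) ^ n"
    using square_integrable_complete[of M v 4] sqv cauchy unfolding N_def by blast
  have geo: "(\<lambda>n. (1/4::real) ^ n) \<longlonglongrightarrow> 0" by (rule LIMSEQ_power_zero) simp
  have lim0: "(\<lambda>n. K * N (\<lambda>x. u x - v n x)) \<longlonglongrightarrow> 0" for K
  proof -
    have "(\<lambda>n. N (\<lambda>x. u x - v n x)) \<longlonglongrightarrow> 0"
      by (rule real_tendsto_sandwich[of "\<lambda>_. 0" _ _ "\<lambda>n. 4 * (1/4) ^ n"])
        (use N0 conv geo in \<open>auto intro!: tendsto_eq_intros\<close>)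
    from tendsto_mult_left[OF this, of K] show ?thesis by simp
  qed
  \<comment> \<open>Continuity of the pairing in its first argument, from Cauchy-Schwarz and N(u -
    v_n) -> 0.\<close>
  have Blim: "(\<lambda>n. B (v n) w) \<longlonglongrightarrow> B u w" if w: "square_integrable M w" for w
  proof -
    have s: "square_integrable M (\<lambda>x. u x - v n x)" for n
      using square_integrable_add_scaleR[OF u sqv, of "-1"] by simp
    have eq: "B (\<lambda>x. u x - v n x) w = B u w - B (v n) w" for n
      unfolding B_def inner_diff_left
      by (intro Bochner_Integration.integral_diff square_integrable_inner u sqv w)
    have "(\<lambda>n. (B u w - B (v n) w)\<^sup>2) \<longlonglongrightarrow> 0"
      by (rule real_tendsto_sandwich[OF _ _ tendsto_const lim0[of "N w"]])
        (use CS[OF s w] in \<open>auto simp: eq mult.commute\<close>)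
    then have "(\<lambda>n. B u w - B (v n) w) \<longlonglongrightarrow> 0" by (simp add: tendsto_power_zero)
    then have "(\<lambda>n. B u w - (B u w - B (v n) w)) \<longlonglongrightarrow> B u w - 0"
      by (intro tendsto_diff tendsto_const)
    then show ?thesis by simp
  qed
  \<comment> \<open>First variation: moving the minimising sequence by s(w, q) cannot go below
    \<open>m\<close>. In the limit a quadratic in s with constant term 0 is nonnegative, so its
    linear coefficient vanishes.\<close>
  have rep: "B u w = q" if wq: "(w, q) \<in> G" for w q
  proof -
    have "0 + 2 * s * (B u w - q) + s\<^sup>2 * N w \<ge> 0" for s
    proof (rule tendsto_le[OF sequentially_bot])
      show "(\<lambda>n. (1/4) ^ n + 2 * s * (B (v n) w - q) + s\<^sup>2 * N w) \<longlonglongrightarrow> 0 + 2 * s * (B u w - q) + s\<^sup>2 * N w"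
        by (intro tendsto_intros geo Blim sq[OF wq])
      show "\<forall>\<^sub>F n in sequentially. 0 \<le> (1/4) ^ n + 2 * s * (B (v n) w - q) + s\<^sup>2 * N w"
      proof (intro always_eventually allI)
        fix n
        show "0 \<le> (1/4) ^ n + 2 * s * (B (v n) w - q) + s\<^sup>2 * N w"
          using m[OF lin[OF vr wq, of n s]] Qvr[of n] N_add[OF sqv sq[OF wq], of n s]
          by (simp add: Q_def algebra_simps)
      qed
    qed simp
    from quadratic_nonneg_discriminant[OF this N0] show ?thesis by simp
  qed
  \<comment> \<open>Since B(u, v_n) = r_n, the bound reads B(u, v_n)^2 <= C N(v_n), and its limit is
    N(u)^2 <= C N(u).\<close>
  have "(\<lambda>n. B u (v n)) \<longlonglongrightarrow> N u"
    using Blim[OF u] by (simp add: B_def N_def inner_commute power2_norm_eq_inner)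
  moreover from this lim0[of 1] have "(\<lambda>n. 1 * N (\<lambda>x. u x - v n x) - N u + 2 * B u (v n)) \<longlonglongrightarrow> 0 - N u + 2 * N u"
    by (intro tendsto_intros)
  then have "(\<lambda>n. N (v n)) \<longlonglongrightarrow> N u" by (simp add: N_diff[OF u sqv])
  moreover have "(B u (v n))\<^sup>2 \<le> C * N (v n)" for n
    using bound[OF vr] rep[OF vr] by (simp add: N_def)
  ultimately have "(N u)\<^sup>2 \<le> C * N u"
    by (intro tendsto_le[OF sequentially_bot, of "\<lambda>n. C * N (v n)" _ "\<lambda>n. (B u (v n))\<^sup>2"] tendsto_intros)
      auto
  then have "N u \<le> C"
    using N0[of u] \<open>C \<ge> 0\<close> by (cases "N u = 0") (auto simp: power2_eq_square)
  with u rep show ?thesis by (intro that) (auto simp: N_def B_def)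
qed

section \<open>Test functions and local integrability\<close>

text \<open>Asking for some compact set, rather than compactness of the closed support, makes the
  property pass directly to sums, products and derivatives.\<close>

definition compactly_supported_in :: "'a::topological_space set \<Rightarrow> ('a \<Rightarrow> 'b::zero) \<Rightarrow> bool" where
  "compactly_supported_in \<Omega> b \<longleftrightarrow> (\<exists>K. compact K \<and> K \<subseteq> \<Omega> \<and> (\<forall>x. x \<notin> K \<longrightarrow> b x = 0))"

definition locally_integrable :: "'a::euclidean_space set \<Rightarrow> ('a \<Rightarrow> 'b::euclidean_space) \<Rightarrow> bool" where
  "locally_integrable \<Omega> h \<longleftrightarrow> h \<in> borel_measurable (lebesgue_on \<Omega>) \<and>
     (\<forall>K. compact K \<longrightarrow> K \<subseteq> \<Omega> \<longrightarrow> integrable (lebesgue_on \<Omega>) (\<lambda>x. indicator K x *\<^sub>R h x))"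

text \<open>A continuous factor is bounded on each compact subset of \<open>\<Omega>\<close>, though
  possibly unbounded on \<open>\<Omega>\<close>.\<close>

lemma locally_integrable_scaleR:
  assumes "open \<Omega>" "continuous_on \<Omega> g" "locally_integrable \<Omega> h"
  shows "locally_integrable \<Omega> (\<lambda>x. g x *\<^sub>R h x)"
  unfolding locally_integrable_def
proof (intro conjI allI impI)
  have g: "g \<in> borel_measurable (lebesgue_on \<Omega>)"
    using assms by (intro continuous_imp_measurable_on_sets_lebesgue) auto
  then show "(\<lambda>x. g x *\<^sub>R h x) \<in> borel_measurable (lebesgue_on \<Omega>)"
    using assms(3) by (intro borel_measurable_scaleR) (auto simp: locally_integrable_def)
  fix K assume K: "compact K" "K \<subseteq> \<Omega>"
  then have int: "integrable (lebesgue_on \<Omega>) (\<lambda>x. indicator K x *\<^sub>R h x)"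
    using assms(3) by (simp add: locally_integrable_def)
  have "compact (g ` K)"
    using K assms(2) by (intro compact_continuous_image) (auto intro: continuous_on_subset)
  then obtain B where B: "\<And>x. x \<in> K \<Longrightarrow> \<bar>g x\<bar> \<le> B"
    by (metis bounded_iff compact_imp_bounded image_eqI real_norm_def)
  show "integrable (lebesgue_on \<Omega>) (\<lambda>x. indicator K x *\<^sub>R g x *\<^sub>R h x)"
  proof (rule Bochner_Integration.integrable_bound)
    show "integrable (lebesgue_on \<Omega>) (\<lambda>x. B *\<^sub>R (indicator K x *\<^sub>R h x))"
      using int by (rule integrable_scaleR_right)
    have "(\<lambda>x. g x *\<^sub>R (indicator K x *\<^sub>R h x)) \<in> borel_measurable (lebesgue_on \<Omega>)"
      by (rule borel_measurable_scaleR[OF g borel_measurable_integrable[OF int]])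
    then show "(\<lambda>x. indicator K x *\<^sub>R g x *\<^sub>R h x) \<in> borel_measurable (lebesgue_on \<Omega>)"
      by (simp add: mult.commute)
    have "\<bar>g x\<bar> * norm (h x) \<le> \<bar>B\<bar> * norm (h x)" if "x \<in> K" for x
      using B[OF that] by (intro mult_right_mono) auto
    then show "AE x in lebesgue_on \<Omega>. norm (indicator K x *\<^sub>R g x *\<^sub>R h x) \<le> norm (B *\<^sub>R (indicator K x *\<^sub>R h x))"
      by (auto simp: indicator_def)
  qed
qed

lemma locally_integrable_bounded_linear:
  assumes "bounded_linear T" "locally_integrable \<Omega> h"
  shows "locally_integrable \<Omega> (\<lambda>x. T (h x))"
  unfolding locally_integrable_def
proof (intro conjI allI impI)
  have "T \<in> borel_measurable borel"
    using assms(1) by (intro borel_measurable_continuous_onI linear_continuous_on)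
  then show "(\<lambda>x. T (h x)) \<in> borel_measurable (lebesgue_on \<Omega>)"
    using assms(2) by (auto simp: locally_integrable_def intro: measurable_compose)
  fix K assume "compact K" "K \<subseteq> \<Omega>"
  then have "integrable (lebesgue_on \<Omega>) (\<lambda>x. T (indicator K x *\<^sub>R h x))"
    using assms by (intro integrable_bounded_linear[OF assms(1)]) (simp add: locally_integrable_def)
  then show "integrable (lebesgue_on \<Omega>) (\<lambda>x. indicator K x *\<^sub>R T (h x))"
    by (simp add: linear_cmul[OF bounded_linear.linear[OF assms(1)]])
qed

lemma locally_integrable_add:
  assumes "locally_integrable \<Omega> g" "locally_integrable \<Omega> h"
  shows "locally_integrable \<Omega> (\<lambda>x. g x + h x)"
  using assms unfolding locally_integrable_def by (auto simp: scaleR_add_right)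

lemma locally_integrable_sum:
  assumes "\<And>i. i \<in> I \<Longrightarrow> locally_integrable \<Omega> (h i)"
  shows "locally_integrable \<Omega> (\<lambda>x. \<Sum>i\<in>I. h i x)"
  using assms unfolding locally_integrable_def
  by (auto simp: scaleR_sum_right intro!: borel_measurable_sum)

lemma integrable_compact_support:
  assumes "open \<Omega>" "locally_integrable \<Omega> h" "continuous_on \<Omega> g" "compactly_supported_in \<Omega> g"
  shows "integrable (lebesgue_on \<Omega>) (\<lambda>x. g x *\<^sub>R h x)"
proof -
  obtain K where K: "compact K" "K \<subseteq> \<Omega>" "\<And>x. x \<notin> K \<Longrightarrow> g x = 0"
    using assms(4) by (auto simp: compactly_supported_in_def)
  have "integrable (lebesgue_on \<Omega>) (\<lambda>x. indicator K x *\<^sub>R g x *\<^sub>R h x)"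
    using locally_integrable_scaleR[OF assms(1,3,2)] K by (simp add: locally_integrable_def)
  also have "(\<lambda>x. indicator K x *\<^sub>R g x *\<^sub>R h x) = (\<lambda>x. g x *\<^sub>R h x)"
  proof (rule ext)
    show "indicator K x *\<^sub>R g x *\<^sub>R h x = g x *\<^sub>R h x" for x
      using K(3)[of x] by (cases "x \<in> K") auto
  qed
  finally show ?thesis .
qed

lemma norm_integral_compact_support_le:
  assumes "open \<Omega>" "locally_integrable \<Omega> h" "continuous_on \<Omega> g"
    and K: "compact K" "K \<subseteq> \<Omega>" "\<And>x. x \<notin> K \<Longrightarrow> g x = 0" and e: "\<And>x. \<bar>g x\<bar> \<le> e"
  shows "norm (LINT x|lebesgue_on \<Omega>. g x *\<^sub>R h x) \<le> e * (LINT x|lebesgue_on \<Omega>. norm (indicator K x *\<^sub>R h x))"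
proof -
  have int: "integrable (lebesgue_on \<Omega>) (\<lambda>x. norm (indicator K x *\<^sub>R h x))"
    using assms(2) K by (intro integrable_norm) (simp add: locally_integrable_def)
  have "norm (LINT x|lebesgue_on \<Omega>. g x *\<^sub>R h x) \<le> (LINT x|lebesgue_on \<Omega>. norm (g x *\<^sub>R h x))"
    by (rule integral_norm_bound)
  also have "\<dots> \<le> (LINT x|lebesgue_on \<Omega>. e * norm (indicator K x *\<^sub>R h x))"
  proof (rule integral_mono)
    show "integrable (lebesgue_on \<Omega>) (\<lambda>x. norm (g x *\<^sub>R h x))"
      using assms by (intro integrable_norm integrable_compact_support) (auto simp: compactly_supported_in_def)
    show "integrable (lebesgue_on \<Omega>) (\<lambda>x. e * norm (indicator K x *\<^sub>R h x))"
      using int by simp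
    show "norm (g x *\<^sub>R h x) \<le> e * norm (indicator K x *\<^sub>R h x)" for x
      using e[of x] K(3)[of x] by (cases "x \<in> K") (auto intro: mult_right_mono)
  qed
  finally show ?thesis by simp
qed

lemma integrable_indicator_compact:
  fixes \<Omega> :: "'a::euclidean_space set"
  assumes "open \<Omega>" "compact K" "K \<subseteq> \<Omega>"
  shows "integrable (lebesgue_on \<Omega>) (indicator K :: 'a \<Rightarrow> real)"
proof -
  have "integrable lebesgue (indicator K :: 'a \<Rightarrow> real)"
    using lmeasurable_compact[OF assms(2)] by (simp add: lmeasurable_iff_integrable)
  moreover have "(\<lambda>x. indicator \<Omega> x *\<^sub>R indicator K x) = (indicator K :: 'a \<Rightarrow> real)"
    using assms(3) by (intro ext) (auto simp: indicator_def)
  ultimately show ?thesis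
    using assms(1) by (subst integrable_restrict_space) auto
qed

text \<open>Compact sets have finite measure, and y <= 1 + y^2 dominates the norm by its
  square.\<close>

lemma square_integrable_locally_integrable:
  assumes "open \<Omega>" "square_integrable (lebesgue_on \<Omega>) h"
  shows "locally_integrable \<Omega> h"
  unfolding locally_integrable_def
proof (intro conjI allI impI)
  show "h \<in> borel_measurable (lebesgue_on \<Omega>)" using assms(2) by (simp add: square_integrable_def)
  fix K assume K: "compact K" "K \<subseteq> \<Omega>"
  note ind = integrable_indicator_compact[OF assms(1) K]
  show "integrable (lebesgue_on \<Omega>) (\<lambda>x. indicator K x *\<^sub>R h x)"
  proof (rule Bochner_Integration.integrable_bound)
    show "integrable (lebesgue_on \<Omega>) (\<lambda>x. indicator K x + (norm (h x))\<^sup>2)"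
      using ind assms(2) by (intro Bochner_Integration.integrable_add) (auto simp: square_integrable_def)
    show "(\<lambda>x. indicator K x *\<^sub>R h x) \<in> borel_measurable (lebesgue_on \<Omega>)"
      using ind assms(2) by (intro borel_measurable_scaleR) (auto simp: square_integrable_def)
    have "y \<le> 1 + y\<^sup>2" for y :: real
    proof -
      have "(y - 1)\<^sup>2 = y\<^sup>2 - 2 * y + 1" by (simp add: power2_diff)
      then show ?thesis using zero_le_power2[of "y - 1"] zero_le_power2[of y] by linarith
    qed
    then show "AE x in lebesgue_on \<Omega>. norm (indicator K x *\<^sub>R h x) \<le> norm (indicator K x + (norm (h x))\<^sup>2)"
      by (auto simp: indicator_def)
  qed
qed

lemma square_integrable_compact_support:
  fixes g :: "'a::euclidean_space \<Rightarrow> 'b::euclidean_space"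
  assumes "open \<Omega>" "continuous_on \<Omega> g" "compactly_supported_in \<Omega> g"
  shows "square_integrable (lebesgue_on \<Omega>) g"
proof -
  have "locally_integrable \<Omega> (\<lambda>_. 1 :: real)"
    using integrable_indicator_compact[OF assms(1)] by (simp add: locally_integrable_def)
  then have "integrable (lebesgue_on \<Omega>) (\<lambda>x. (norm (g x))\<^sup>2 *\<^sub>R (1 :: real))"
    using assms by (intro integrable_compact_support continuous_intros)
      (auto simp: compactly_supported_in_def)
  moreover have "g \<in> borel_measurable (lebesgue_on \<Omega>)"
    using assms by (intro continuous_imp_measurable_on_sets_lebesgue) auto
  ultimately show ?thesis by (simp add: square_integrable_def)
qed

section \<open>Continuously differentiable functions of compact support\<close>

lemma Ck_on_1_iff:
  fixes g :: "'n::{finite,linorder} point \<Rightarrow> real"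
  shows "Ck_on 1 S g \<longleftrightarrow> (\<forall>x\<in>S. g differentiable (at x)) \<and> (\<forall>i. continuous_on S (pd i g))"
  by (auto simp: Basis_vec_def pd_def[abs_def])

lemma Ck_on_1_continuous: "Ck_on 1 S g \<Longrightarrow> continuous_on S g"
  by (auto intro!: continuous_at_imp_continuous_on differentiable_imp_continuous_within)

lemma smooth_imp_Ck_on_1: "smooth g \<Longrightarrow> Ck_on 1 UNIV g"
  unfolding smooth_def by blast

lemma pd_eq:
  assumes "(g has_derivative g') (at x)" shows "pd i g x = g' (axis i 1)"
  unfolding pd_def using frechet_derivative_at[OF assms] by simp

lemma compactly_supported_in_pd:
  assumes "compactly_supported_in \<Omega> b" shows "compactly_supported_in \<Omega> (pd i b)"
  using assms unfolding compactly_supported_in_def pd_def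
  by (metis frechet_derivative_zero_outside compact_imp_closed)

text \<open>The weight is controlled on \<open>\<Omega>\<close> only. The open sets
  \<open>\<Omega>\<close> and the complement of the compact set carrying \<open>b\<close> cover the
  space; on the first the product rule applies, on the second the product is 0.\<close>

lemma
  assumes \<Omega>: "open \<Omega>" and \<psi>: "Ck_on 1 \<Omega> \<psi>" and b: "Ck_on 1 UNIV b" "compactly_supported_in \<Omega> b"
  shows Ck_on_1_weighted: "Ck_on 1 UNIV (\<lambda>x. \<psi> x * b x)"
    and compactly_supported_in_weighted: "compactly_supported_in \<Omega> (\<lambda>x. \<psi> x * b x)"
    and pd_weighted: "x \<in> \<Omega> \<Longrightarrow> pd i (\<lambda>x. \<psi> x * b x) x = \<psi> x * pd i b x + pd i \<psi> x * b x"
proof -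
  obtain K where K: "compact K" "K \<subseteq> \<Omega>" "\<And>x. x \<notin> K \<Longrightarrow> b x = 0"
    using b(2) by (auto simp: compactly_supported_in_def)
  let ?w = "\<lambda>x. \<psi> x * b x"
  show "compactly_supported_in \<Omega> ?w"
    unfolding compactly_supported_in_def using K by (intro exI[of _ K]) auto
  have d: "(?w has_derivative (\<lambda>v. \<psi> x * frechet_derivative b (at x) v + frechet_derivative \<psi> (at x) v * b x)) (at x)"
    if "x \<in> \<Omega>" for x
    using \<psi> b(1) that unfolding Ck_on_1_iff
    by (intro has_derivative_mult) (auto simp: frechet_derivative_works[symmetric])
  then have pd: "pd i ?w x = \<psi> x * pd i b x + pd i \<psi> x * b x" if "x \<in> \<Omega>" for x i
    using pd_eq[OF d[OF that]] by (simp add: pd_def)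
  then show "x \<in> \<Omega> \<Longrightarrow> pd i ?w x = \<psi> x * pd i b x + pd i \<psi> x * b x" .
  have closed: "closed K" using K(1) by (rule compact_imp_closed)
  have "?w differentiable (at x)" for x
  proof (cases "x \<in> \<Omega>")
    case True
    then show ?thesis using d differentiable_def by blast
  next
    case False
    have "((\<lambda>_. 0) has_derivative (\<lambda>_. 0)) (at x)" by simp
    then have "(?w has_derivative (\<lambda>_. 0)) (at x)"
      by (rule has_derivative_transform_within_open[of _ _ _ _ "- K"]) (use closed K False in auto)
    then show ?thesis by (auto simp: differentiable_def)
  qed
  moreover have "continuous_on UNIV (pd i ?w)" for i
  proof -
    have "continuous_on \<Omega> (\<lambda>x. \<psi> x * pd i b x + pd i \<psi> x * b x)"
      using \<psi> b(1) Ck_on_1_continuous[OF \<psi>] Ck_on_1_continuous[OF b(1)] unfolding Ck_on_1_iff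
      by (auto intro!: continuous_intros intro: continuous_on_subset)
    then have "continuous_on \<Omega> (pd i ?w)"
      using pd by (subst continuous_on_cong[OF refl]) auto
    moreover have "pd i ?w x = 0" if "x \<notin> K" for x
      unfolding pd_def using closed K(3) that by (intro frechet_derivative_zero_outside[of K]) auto
    then have "continuous_on (- K) (pd i ?w)"
      by (subst continuous_on_cong[OF refl, of _ _ "\<lambda>_. 0"]) auto
    ultimately have "continuous_on (\<Omega> \<union> - K) (pd i ?w)"
      using \<Omega> closed by (intro continuous_on_open_Un) auto
    moreover have "\<Omega> \<union> - K = UNIV" using K(2) by auto
    ultimately show ?thesis by simp
  qed
  ultimately show "Ck_on 1 UNIV ?w" by (simp only: Ck_on_1_iff) auto
qed

text \<open>The constant allows both weights exp(-phi) and exp(phi) to be covered at once.\<close>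

lemma Ck_on_1_exp:
  fixes \<phi> :: "'n::{finite,linorder} point \<Rightarrow> real"
  assumes "Ck_on 1 \<Omega> \<phi>" shows "Ck_on 1 \<Omega> (\<lambda>x. exp (c * \<phi> x))"
proof -
  have d: "((\<lambda>x. exp (c * \<phi> x)) has_derivative (\<lambda>v. exp (c * \<phi> x) * (c * frechet_derivative \<phi> (at x) v))) (at x)"
    if "x \<in> \<Omega>" for x
  proof -
    have "(\<phi> has_derivative frechet_derivative \<phi> (at x)) (at x)"
      using assms that by (auto simp: frechet_derivative_works[symmetric])
    then show ?thesis by (auto intro!: derivative_eq_intros)
  qed
  have "continuous_on \<Omega> (\<lambda>x. exp (c * \<phi> x) * (c * pd i \<phi> x))" for i
    using assms Ck_on_1_continuous[OF assms] unfolding Ck_on_1_iff by (auto intro!: continuous_intros)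
  then have "continuous_on \<Omega> (pd i (\<lambda>x. exp (c * \<phi> x)))" for i
    using pd_eq[OF d] by (subst continuous_on_cong[OF refl]) (auto simp: pd_def)
  moreover have "(\<lambda>x. exp (c * \<phi> x)) differentiable (at x)" if "x \<in> \<Omega>" for x
    using d[OF that] differentiable_def by blast
  ultimately show ?thesis by (simp only: Ck_on_1_iff) auto
qed

lemma Ck_on_2_imp_1: "Ck_on 2 S g \<Longrightarrow> Ck_on 1 S g"
  by (auto simp: numeral_2_eq_2 intro!: continuous_at_imp_continuous_on differentiable_imp_continuous_within)

section \<open>Extending weak identities to C^1 test functions\<close>

text \<open>The data \<open>F\<close> and \<open>H\<close> are kept arbitrary because multiplying
  the test function by a weight changes them; the equation itself is the case F = f, H_i = e_i
  u.\<close>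

definition weak_pairing ::
  "'n::{finite,linorder} point set \<Rightarrow> ('n point \<Rightarrow> 'b::euclidean_space) \<Rightarrow>
     ('n option \<Rightarrow> 'n point \<Rightarrow> 'b) \<Rightarrow> ('n point \<Rightarrow> real) \<Rightarrow> 'b" where
  "weak_pairing \<Omega> F H b = (LINT x|lebesgue_on \<Omega>. b x *\<^sub>R F x) +
     (\<Sum>i\<in>UNIV. LINT x|lebesgue_on \<Omega>. pd i b x *\<^sub>R H i x)"

lemma integrable_test:
  fixes b :: "'n::{finite,linorder} point \<Rightarrow> real"
  assumes "open \<Omega>" "Ck_on 1 UNIV b" "compactly_supported_in \<Omega> b" "locally_integrable \<Omega> h"
  shows "integrable (lebesgue_on \<Omega>) (\<lambda>x. b x *\<^sub>R h x)"
    and "integrable (lebesgue_on \<Omega>) (\<lambda>x. pd i b x *\<^sub>R h x)"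
proof -
  have "continuous_on \<Omega> b" using Ck_on_1_continuous[OF assms(2)] by (rule continuous_on_subset) simp
  then show "integrable (lebesgue_on \<Omega>) (\<lambda>x. b x *\<^sub>R h x)"
    using assms by (intro integrable_compact_support)
  have "continuous_on \<Omega> (pd i b)"
    using assms(2) unfolding Ck_on_1_iff by (auto intro: continuous_on_subset)
  then show "integrable (lebesgue_on \<Omega>) (\<lambda>x. pd i b x *\<^sub>R h x)"
    using assms by (intro integrable_compact_support compactly_supported_in_pd)
qed

text \<open>A mollification g within e of b in C^1 norm changes the pairing by at most e C, with C
  independent of e because all supports stay in one compact subset of
  \<open>\<Omega>\<close>.\<close>

lemma weak_pairing_extends:
  fixes F :: "'n::{finite,linorder} point \<Rightarrow> 'b::euclidean_space"
  assumes \<Omega>: "open \<Omega>" and F: "locally_integrable \<Omega> F" and H: "\<And>i. locally_integrable \<Omega> (H i)"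
    and zero: "\<And>b. smooth b \<Longrightarrow> compactly_supported_in \<Omega> b \<Longrightarrow> weak_pairing \<Omega> F H b = 0"
    and b: "Ck_on 1 UNIV b" "compactly_supported_in \<Omega> b"
  shows "weak_pairing \<Omega> F H b = 0"
proof -
  obtain K where K: "compact K" "K \<subseteq> \<Omega>" "\<And>x. x \<notin> K \<Longrightarrow> b x = 0"
    using b(2) by (auto simp: compactly_supported_in_def)
  obtain d where d: "d > 0" "(\<Union>x\<in>K. cball x d) \<subseteq> \<Omega>"
    using compact_subset_open_imp_cball_epsilon_subset[OF K(1) \<Omega> K(2)] by blast
  define S where "S = (\<Union>x\<in>K. cball x d)"
  \<comment> \<open>As a sum of two compact sets, the closed \<open>d\<close>-neighbourhood of
    \<open>K\<close> is compact.\<close>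
  have "S = {x + y |x y. x \<in> K \<and> y \<in> cball 0 d}"
  proof safe
    fix z assume "z \<in> S"
    then obtain x where "x \<in> K" "dist x z \<le> d" by (auto simp: S_def)
    then have "z = x + (z - x) \<and> x \<in> K \<and> z - x \<in> cball 0 d"
      by (simp add: dist_norm norm_minus_commute)
    then show "\<exists>x y. z = x + y \<and> x \<in> K \<and> y \<in> cball 0 d" by blast
  next
    fix x y :: "'n point" assume "x \<in> K" "y \<in> cball 0 d"
    then show "x + y \<in> S" unfolding S_def by (intro UN_I[of x]) (auto simp: dist_norm)
  qed
  then have S: "compact S" "S \<subseteq> \<Omega>"
    using compact_sums[OF K(1) compact_cball[of 0 d]] d by (auto simp: S_def)
  define C where "C = (LINT x|lebesgue_on \<Omega>. norm (indicator S x *\<^sub>R F x)) +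
     (\<Sum>i\<in>UNIV. LINT x|lebesgue_on \<Omega>. norm (indicator S x *\<^sub>R H i x))"
  have "C \<ge> 0" unfolding C_def by (intro add_nonneg_nonneg sum_nonneg Bochner_Integration.integral_nonneg) auto
  have le: "norm (weak_pairing \<Omega> F H b) \<le> e * C" if e: "e > 0" "e \<le> d" for e
  proof -
    obtain g where g: "smooth g" "\<And>x. g x \<noteq> 0 \<Longrightarrow> \<exists>y\<in>K. dist y x \<le> e" "\<And>x. \<bar>g x - b x\<bar> \<le> e"
      "\<And>x v. v \<in> Basis \<Longrightarrow> \<bar>frechet_derivative g (at x) v - frechet_derivative b (at x) v\<bar> \<le> e"
      using smooth_approximation[OF b(1) K(1,3) e(1)] by blast
    have gS: "g x = 0" if "x \<notin> S" for x using g(2)[of x] that e(2) by (force simp: S_def)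
    have bS: "b x = 0" if "x \<notin> S" for x
    proof -
      have "K \<subseteq> S" using d(1) by (force simp: S_def)
      then show ?thesis using that K(3) by blast
    qed
    have csg: "compactly_supported_in \<Omega> g"
      unfolding compactly_supported_in_def using S gS by blast
    note g1 = smooth_imp_Ck_on_1[OF g(1)]
    have cont: "continuous_on \<Omega> f" if "continuous_on UNIV f" for f :: "'n point \<Rightarrow> real"
      using that by (rule continuous_on_subset) simp
    have "norm (LINT x|lebesgue_on \<Omega>. (g x - b x) *\<^sub>R F x) \<le>
        e * (LINT x|lebesgue_on \<Omega>. norm (indicator S x *\<^sub>R F x))"
      using gS bS g(3) b(1) g1
      by (intro norm_integral_compact_support_le \<Omega> F S cont continuous_intros Ck_on_1_continuous) auto
    moreover have "norm (LINT x|lebesgue_on \<Omega>. (pd i g x - pd i b x) *\<^sub>R H i x) \<le>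
        e * (LINT x|lebesgue_on \<Omega>. norm (indicator S x *\<^sub>R H i x))" for i
    proof (intro norm_integral_compact_support_le \<Omega> H S cont continuous_intros)
      show "continuous_on UNIV (pd i g)" "continuous_on UNIV (pd i b)"
        using g1 b(1) unfolding Ck_on_1_iff by auto
      show "pd i g x - pd i b x = 0" if "x \<notin> S" for x
        using frechet_derivative_zero_outside[OF compact_imp_closed[OF S(1)], of g]
          frechet_derivative_zero_outside[OF compact_imp_closed[OF S(1)], of b] gS bS that
        by (simp add: pd_def)
      show "\<bar>pd i g x - pd i b x\<bar> \<le> e" for x unfolding pd_def by (intro g(4)) simp
    qed
    ultimately have "norm ((LINT x|lebesgue_on \<Omega>. (g x - b x) *\<^sub>R F x) +
       (\<Sum>i\<in>UNIV. LINT x|lebesgue_on \<Omega>. (pd i g x - pd i b x) *\<^sub>R H i x)) \<le> e * C"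
      unfolding C_def distrib_left sum_distrib_left
      by (intro order_trans[OF norm_triangle_ineq] add_mono order_trans[OF norm_sum] sum_mono)
    also have "(LINT x|lebesgue_on \<Omega>. (g x - b x) *\<^sub>R F x) +
       (\<Sum>i\<in>UNIV. LINT x|lebesgue_on \<Omega>. (pd i g x - pd i b x) *\<^sub>R H i x) =
       weak_pairing \<Omega> F H g - weak_pairing \<Omega> F H b"
      unfolding weak_pairing_def scaleR_diff_left
      by (simp add: Bochner_Integration.integral_diff integrable_test[OF \<Omega> b F] integrable_test[OF \<Omega> g1 csg F]
          integrable_test[OF \<Omega> b H] integrable_test[OF \<Omega> g1 csg H] sum_subtractf)
    also have "weak_pairing \<Omega> F H g = 0" using zero g(1) csg by blast
    finally show ?thesis by simp
  qed
  show ?thesis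
  proof (rule ccontr)
    assume "weak_pairing \<Omega> F H b \<noteq> 0"
    then have N: "norm (weak_pairing \<Omega> F H b) > 0" (is "?N > 0") by simp
    \<comment> \<open>The summand 1 keeps the denominator positive when \<open>C = 0\<close>; the
      bound then yields \<open>?N \<le> ?N / 2\<close>.\<close>
    define e where "e = min d (?N / (2 * (C + 1)))"
    have "e > 0" using d N \<open>C \<ge> 0\<close> by (simp add: e_def)
    then have "?N \<le> e * C" using le by (simp add: e_def)
    also have "\<dots> \<le> ?N / (2 * (C + 1)) * (C + 1)"
      using \<open>C \<ge> 0\<close> \<open>e > 0\<close> by (intro mult_mono) (auto simp: e_def)
    also have "y / (2 * k) * k = y / 2" if "k > 0" for y k :: real
      using that by simp
    from this[of "C + 1" ?N] have "?N / (2 * (C + 1)) * (C + 1) = ?N / 2" using \<open>C \<ge> 0\<close> by simp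
    finally show False using N by simp
  qed
qed

text \<open>By the product rule the pairing of (F, H) with \<open>\<psi> b\<close> is the pairing of
  new data (F', H') with \<open>b\<close>, where the terms containing derivatives of
  \<open>\<psi>\<close> have moved into F'. The unweighted extension applies to the new
  data.\<close>

lemma weak_pairing_weighted_extends:
  fixes F :: "'n::{finite,linorder} point \<Rightarrow> 'b::euclidean_space"
  assumes \<Omega>: "open \<Omega>" and \<psi>: "Ck_on 1 \<Omega> \<psi>"
    and F: "locally_integrable \<Omega> F" and H: "\<And>i. locally_integrable \<Omega> (H i)"
    and zero: "\<And>b. smooth b \<Longrightarrow> compactly_supported_in \<Omega> b \<Longrightarrow> weak_pairing \<Omega> F H (\<lambda>x. \<psi> x * b x) = 0"
    and b: "Ck_on 1 UNIV b" "compactly_supported_in \<Omega> b"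
  shows "weak_pairing \<Omega> F H (\<lambda>x. \<psi> x * b x) = 0"
proof -
  define F' where "F' = (\<lambda>x. \<psi> x *\<^sub>R F x + (\<Sum>i\<in>UNIV. pd i \<psi> x *\<^sub>R H i x))"
  define H' where "H' = (\<lambda>i x. \<psi> x *\<^sub>R H i x)"
  note c\<psi> = Ck_on_1_continuous[OF \<psi>]
  have c\<psi>': "continuous_on \<Omega> (pd i \<psi>)" for i using \<psi> by (simp only: Ck_on_1_iff)
  have \<psi>H: "locally_integrable \<Omega> (\<lambda>x. pd i \<psi> x *\<^sub>R H i x)" for i
    by (rule locally_integrable_scaleR[OF \<Omega> c\<psi>' H])
  have \<psi>F: "locally_integrable \<Omega> (\<lambda>x. \<psi> x *\<^sub>R F x)"
    by (rule locally_integrable_scaleR[OF \<Omega> c\<psi> F])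
  have F': "locally_integrable \<Omega> F'"
    unfolding F'_def by (intro locally_integrable_add locally_integrable_sum \<psi>F \<psi>H)
  have H': "locally_integrable \<Omega> (H' i)" for i
    unfolding H'_def by (rule locally_integrable_scaleR[OF \<Omega> c\<psi> H])
  have eq: "weak_pairing \<Omega> F H (\<lambda>x. \<psi> x * b x) = weak_pairing \<Omega> F' H' b"
    if b: "Ck_on 1 UNIV b" "compactly_supported_in \<Omega> b" for b
  proof -
    have 1: "(LINT x|lebesgue_on \<Omega>. pd i (\<lambda>x. \<psi> x * b x) x *\<^sub>R H i x) =
      (LINT x|lebesgue_on \<Omega>. b x *\<^sub>R pd i \<psi> x *\<^sub>R H i x) + (LINT x|lebesgue_on \<Omega>. pd i b x *\<^sub>R H' i x)" for i
    proof -
      have "(LINT x|lebesgue_on \<Omega>. pd i (\<lambda>x. \<psi> x * b x) x *\<^sub>R H i x) =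
        (LINT x|lebesgue_on \<Omega>. b x *\<^sub>R pd i \<psi> x *\<^sub>R H i x + pd i b x *\<^sub>R H' i x)"
        using pd_weighted[OF \<Omega> \<psi> b]
        by (intro Bochner_Integration.integral_cong refl) (simp add: H'_def algebra_simps)
      also have "\<dots> = (LINT x|lebesgue_on \<Omega>. b x *\<^sub>R pd i \<psi> x *\<^sub>R H i x) + (LINT x|lebesgue_on \<Omega>. pd i b x *\<^sub>R H' i x)"
        by (intro Bochner_Integration.integral_add integrable_test[OF \<Omega> b] \<psi>H H')
      finally show ?thesis .
    qed
    have "(LINT x|lebesgue_on \<Omega>. b x *\<^sub>R F' x) =
      (LINT x|lebesgue_on \<Omega>. (b x *\<^sub>R \<psi> x *\<^sub>R F x) + (\<Sum>i\<in>UNIV. b x *\<^sub>R pd i \<psi> x *\<^sub>R H i x))"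
      by (simp add: F'_def scaleR_add_right scaleR_sum_right)
    also have "\<dots> = (LINT x|lebesgue_on \<Omega>. b x *\<^sub>R \<psi> x *\<^sub>R F x) +
       (LINT x|lebesgue_on \<Omega>. (\<Sum>i\<in>UNIV. b x *\<^sub>R pd i \<psi> x *\<^sub>R H i x))"
      by (intro Bochner_Integration.integral_add Bochner_Integration.integrable_sum
          integrable_test(1)[OF \<Omega> b] \<psi>F \<psi>H)
    also have "(LINT x|lebesgue_on \<Omega>. (\<Sum>i\<in>UNIV. b x *\<^sub>R pd i \<psi> x *\<^sub>R H i x)) =
       (\<Sum>i\<in>UNIV. LINT x|lebesgue_on \<Omega>. b x *\<^sub>R pd i \<psi> x *\<^sub>R H i x)"
      by (intro Bochner_Integration.integral_sum integrable_test(1)[OF \<Omega> b] \<psi>H)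
    finally show ?thesis
      unfolding weak_pairing_def 1 sum.distrib by (simp add: mult.commute)
  qed
  have "weak_pairing \<Omega> F' H' b = 0"
  proof (rule weak_pairing_extends[OF \<Omega> F' H' _ b])
    show "weak_pairing \<Omega> F' H' b = 0" if "smooth b" "compactly_supported_in \<Omega> b" for b
      using zero[OF that] eq[OF smooth_imp_Ck_on_1[OF that(1)] that(2)] by simp
  qed
  with eq[OF b] show ?thesis by simp
qed

lemma smooth_zero: "smooth (\<lambda>_. 0)"
  by (rule bumps_smooth[OF bumps.const])

lemma smooth_add_mult:
  assumes "smooth f" "smooth g" shows "smooth (\<lambda>x. f x + c * g x)"
proof (rule smooth_coinduct)
  let ?S = "{h. \<exists>f g. smooth f \<and> smooth g \<and> h = (\<lambda>x. f x + c * g x)}"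
  show "(\<lambda>x. f x + c * g x) \<in> ?S"
    by (rule CollectI, rule exI[of _ f], rule exI[of _ g]) (simp add: assms)
  fix h assume "h \<in> ?S"
  then obtain f g where fg: "smooth f" "smooth g" and h: "h = (\<lambda>x. f x + c * g x)" by auto
  let ?h' = "\<lambda>x v. frechet_derivative f (at x) v + c * frechet_derivative g (at x) v"
  have "(h has_derivative ?h' x) (at x)" for x
    unfolding h using fg smooth_differentiable
    by (intro has_derivative_add has_derivative_mult_right) (auto simp: frechet_derivative_works[symmetric])
  moreover have "(\<lambda>x. ?h' x v) \<in> ?S" if "v \<in> Basis" for v
    by (rule CollectI, rule exI[of _ "\<lambda>x. frechet_derivative f (at x) v"],
        rule exI[of _ "\<lambda>x. frechet_derivative g (at x) v"])
      (simp add: smooth_derivative[OF fg(1) that] smooth_derivative[OF fg(2) that])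
  ultimately show "\<exists>g'. (\<forall>x. (h has_derivative g' x) (at x)) \<and> (\<forall>v\<in>Basis. (\<lambda>x. g' x v) \<in> ?S)"
    by (intro exI[of _ ?h'] conjI allI ballI)
qed

lemma compactly_supported_in_add_mult:
  fixes f g :: "'a::t2_space \<Rightarrow> real"
  assumes "compactly_supported_in \<Omega> f" "compactly_supported_in \<Omega> g"
  shows "compactly_supported_in \<Omega> (\<lambda>x. f x + c * g x)"
proof -
  obtain K where "compact K" "K \<subseteq> \<Omega>" "\<And>x. x \<notin> K \<Longrightarrow> f x = 0"
    using assms(1) by (auto simp: compactly_supported_in_def)
  moreover obtain L where "compact L" "L \<subseteq> \<Omega>" "\<And>x. x \<notin> L \<Longrightarrow> g x = 0"
    using assms(2) by (auto simp: compactly_supported_in_def)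
  ultimately show ?thesis
    unfolding compactly_supported_in_def by (intro exI[of _ "K \<union> L"]) auto
qed

text \<open>There are finitely many blades, so the union of the compact sets carrying the components
  is compact and contains the closed support.\<close>

lemma test_functions_iff:
  "\<alpha> \<in> test_functions \<Omega> \<longleftrightarrow> (\<forall>A. smooth (\<lambda>x. \<alpha> x $ A) \<and> compactly_supported_in \<Omega> (\<lambda>x. \<alpha> x $ A))"
proof -
  have "compact (closure {x. \<alpha> x \<noteq> 0}) \<and> closure {x. \<alpha> x \<noteq> 0} \<subseteq> \<Omega> \<longleftrightarrow>
      (\<forall>A. compactly_supported_in \<Omega> (\<lambda>x. \<alpha> x $ A))" (is "?l \<longleftrightarrow> ?r")
  proof
    assume ?l
    moreover have "\<alpha> x $ A = 0" if "x \<notin> closure {x. \<alpha> x \<noteq> 0}" for x A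
    proof -
      have "x \<notin> {x. \<alpha> x \<noteq> 0}" using that closure_subset[of "{x. \<alpha> x \<noteq> 0}"] by (rule contra_subsetD[rotated])
      then show ?thesis by simp
    qed
    ultimately show ?r unfolding compactly_supported_in_def by blast
  next
    assume ?r
    then obtain K where K: "\<And>A. compact (K A)" "\<And>A. K A \<subseteq> \<Omega>" "\<And>A x. x \<notin> K A \<Longrightarrow> \<alpha> x $ A = 0"
      unfolding compactly_supported_in_def choice_iff by blast
    have "compact (\<Union>A. K A)" using K(1) by (intro compact_UN) auto
    moreover have "closure {x. \<alpha> x \<noteq> 0} \<subseteq> (\<Union>A. K A)"
      using K(3) \<open>compact (\<Union>A. K A)\<close>
      by (intro closure_minimal compact_imp_closed) (auto simp: vec_eq_iff)
    moreover from calculation have "compact (closure {x. \<alpha> x \<noteq> 0})"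
      using compact_Int_closed[of "\<Union>A. K A" "closure {x. \<alpha> x \<noteq> 0}"] by (simp add: inf.absorb2)
    ultimately show ?l using K(2) by blast
  qed
  then show ?thesis unfolding test_functions_def smooth_def by blast
qed

section \<open>Weak solutions and the weighted pairing\<close>

lemma test_functions_smooth: "\<alpha> \<in> test_functions \<Omega> \<Longrightarrow> smooth (\<lambda>x. \<alpha> x $ A)"
  and test_functions_supported: "\<alpha> \<in> test_functions \<Omega> \<Longrightarrow> compactly_supported_in \<Omega> (\<lambda>x. \<alpha> x $ A)"
  by (simp_all add: test_functions_iff)

lemma scaled_blade_test_function:
  assumes "smooth b" "compactly_supported_in \<Omega> b"
  shows "(\<lambda>x. b x *\<^sub>R blade A) \<in> test_functions \<Omega>"
proof -
  have "compactly_supported_in \<Omega> (\<lambda>_. 0 :: real)"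
    unfolding compactly_supported_in_def by (rule exI[of _ "{}"]) simp
  then show ?thesis
    using assms by (auto simp: test_functions_iff blade_nth smooth_zero)
qed

lemma test_functions_add_scaleR:
  assumes "\<alpha> \<in> test_functions \<Omega>" "\<beta> \<in> test_functions \<Omega>"
  shows "(\<lambda>x. \<alpha> x + s *\<^sub>R \<beta> x) \<in> test_functions \<Omega>"
  using assms by (simp add: test_functions_iff smooth_add_mult compactly_supported_in_add_mult)

lemma pd_add_mult:
  assumes "f differentiable (at x)" "g differentiable (at x)"
  shows "pd i (\<lambda>x. f x + c * g x) x = pd i f x + c * pd i g x"
proof -
  have "((\<lambda>x. f x + c * g x) has_derivative
      (\<lambda>v. frechet_derivative f (at x) v + c * frechet_derivative g (at x) v)) (at x)"
    using assms by (intro has_derivative_add has_derivative_mult_right)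
      (auto simp: frechet_derivative_works[symmetric])
  from pd_eq[OF this] show ?thesis by (simp add: pd_def)
qed

lemma test_function_weighted:
  assumes "open \<Omega>" "Ck_on 1 \<Omega> \<phi>" "\<alpha> \<in> test_functions \<Omega>"
  shows "Ck_on 1 UNIV (\<lambda>x. exp (- \<phi> x) * \<alpha> x $ A)"
    and "compactly_supported_in \<Omega> (\<lambda>x. exp (- \<phi> x) * \<alpha> x $ A)"
proof -
  note a = smooth_imp_Ck_on_1[OF test_functions_smooth[OF assms(3)]] test_functions_supported[OF assms(3)]
  note w = Ck_on_1_exp[OF assms(2), of "-1"]
  show "Ck_on 1 UNIV (\<lambda>x. exp (- \<phi> x) * \<alpha> x $ A)"
    using Ck_on_1_weighted[OF assms(1) w a] by simp
  show "compactly_supported_in \<Omega> (\<lambda>x. exp (- \<phi> x) * \<alpha> x $ A)"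
    using compactly_supported_in_weighted[OF assms(1) w a] by simp
qed

lemma Dbar_dual_eq:
  "Dbar_dual \<phi> \<alpha> x = - exp (\<phi> x) *\<^sub>R
     (\<Sum>i\<in>UNIV. \<Sum>A\<in>UNIV. pd i (\<lambda>x. exp (- \<phi> x) * \<alpha> x $ A) x *\<^sub>R (cconj (gen i) \<odot> blade A))"
  by (simp add: Dbar_dual_def Dop_def)

lemma bounded_linear_conj_blade: "bounded_linear (\<lambda>v. cconj v \<odot> blade A)"
  by (rule bounded_linear_compose[OF bounded_linear_cmult_left bounded_linear_cconj])

context
  fixes \<Omega> :: "'n::{finite,linorder} point set" and f u :: "'n point \<Rightarrow> 'n clifford"
  assumes \<Omega>: "open \<Omega>" and f: "locally_integrable \<Omega> f" and u: "locally_integrable \<Omega> u"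
begin

abbreviation (input) defect :: "('n point \<Rightarrow> real) \<Rightarrow> 'n clifford" where
  "defect \<equiv> weak_pairing \<Omega> f (\<lambda>i x. gen i \<odot> u x)"

lemma locally_integrable_gen_cmult: "locally_integrable \<Omega> (\<lambda>x. gen i \<odot> u x)"
  by (rule locally_integrable_bounded_linear[OF bounded_linear_cmult_right u])

lemma defect_zero: "defect (\<lambda>_. 0) = 0"
  by (simp add: weak_pairing_def pd_def)

text \<open>Used for left multiplication by e_A, as in the weak equation, and for v -> conj(v) e_A,
  as in the weighted pairing.\<close>

lemma bounded_linear_defect:
  assumes T: "bounded_linear T" and b: "Ck_on 1 UNIV b" "compactly_supported_in \<Omega> b"
  shows "T (defect b) = (LINT x|lebesgue_on \<Omega>. b x *\<^sub>R T (f x)) +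
     (\<Sum>i\<in>UNIV. LINT x|lebesgue_on \<Omega>. pd i b x *\<^sub>R T (gen i \<odot> u x))"
proof -
  have lin: "linear T" using T by (rule bounded_linear.linear)
  show ?thesis
    unfolding weak_pairing_def linear_add[OF lin] linear_sum[OF lin]
    by (simp add: integral_bounded_linear[OF T, symmetric] linear_scale[OF lin]
        integrable_test[OF \<Omega> b f] integrable_test[OF \<Omega> b locally_integrable_gen_cmult])
qed

text \<open>Associativity turns (e_A e_i) u into e_A (e_i u), so each blade can be pulled out on the
  left. This is why the weak equation uses the operator acting from the right.\<close>

lemma weak_solution_defect:
  assumes \<alpha>: "\<alpha> \<in> test_functions \<Omega>"
  shows "(LINT x|lebesgue_on \<Omega>. \<alpha> x \<odot> f x) + (LINT x|lebesgue_on \<Omega>. Dbar_right \<alpha> x \<odot> u x) =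
     (\<Sum>A\<in>UNIV. blade A \<odot> defect (\<lambda>x. \<alpha> x $ A))"
proof -
  note a = smooth_imp_Ck_on_1[OF test_functions_smooth[OF \<alpha>]] test_functions_supported[OF \<alpha>]
  have Tf: "locally_integrable \<Omega> (\<lambda>x. blade A \<odot> f x)" for A
    by (rule locally_integrable_bounded_linear[OF bounded_linear_cmult_right f])
  have Tu: "locally_integrable \<Omega> (\<lambda>x. blade A \<odot> (gen i \<odot> u x))" for A i
    by (rule locally_integrable_bounded_linear[OF bounded_linear_cmult_right locally_integrable_gen_cmult])
  have "\<alpha> x \<odot> f x = (\<Sum>A\<in>UNIV. \<alpha> x $ A *\<^sub>R (blade A \<odot> f x))" for x
    by (subst clifford_expand[of "\<alpha> x"]) (simp only: cmult_sum_left cmult_scaleR)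
  then have 1: "(LINT x|lebesgue_on \<Omega>. \<alpha> x \<odot> f x) =
      (\<Sum>A\<in>UNIV. LINT x|lebesgue_on \<Omega>. \<alpha> x $ A *\<^sub>R (blade A \<odot> f x))"
    by (simp add: Bochner_Integration.integral_sum integrable_test(1)[OF \<Omega> a Tf])
  have "Dbar_right \<alpha> x \<odot> u x =
      (\<Sum>i\<in>UNIV. \<Sum>A\<in>UNIV. pd i (\<lambda>x. \<alpha> x $ A) x *\<^sub>R (blade A \<odot> (gen i \<odot> u x)))" for x
    by (simp only: Dbar_right_def cmult_sum_left cmult_scaleR cmult_assoc)
  then have "(LINT x|lebesgue_on \<Omega>. Dbar_right \<alpha> x \<odot> u x) =
      (\<Sum>i\<in>UNIV. \<Sum>A\<in>UNIV. LINT x|lebesgue_on \<Omega>. pd i (\<lambda>x. \<alpha> x $ A) x *\<^sub>R (blade A \<odot> (gen i \<odot> u x)))"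
    by (simp add: Bochner_Integration.integral_sum Bochner_Integration.integrable_sum integrable_test(2)[OF \<Omega> a Tu])
  also have "\<dots> = (\<Sum>A\<in>UNIV. \<Sum>i\<in>UNIV.
      LINT x|lebesgue_on \<Omega>. pd i (\<lambda>x. \<alpha> x $ A) x *\<^sub>R (blade A \<odot> (gen i \<odot> u x)))"
    by (rule sum.swap)
  finally show ?thesis
    unfolding 1 bounded_linear_defect[OF bounded_linear_cmult_right a] sum.distrib by simp
qed

lemma weak_solution_iff_defect:
  "weak_solution \<Omega> u f \<longleftrightarrow> (\<forall>b. smooth b \<longrightarrow> compactly_supported_in \<Omega> b \<longrightarrow> defect b = 0)"
proof
  assume weak: "weak_solution \<Omega> u f"
  show "\<forall>b. smooth b \<longrightarrow> compactly_supported_in \<Omega> b \<longrightarrow> defect b = 0"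
  proof (intro allI impI)
    fix b :: "'n point \<Rightarrow> real" assume b: "smooth b" "compactly_supported_in \<Omega> b"
    \<comment> \<open>Multiplication by \<open>blade {}\<close> is the identity and the other
      components are 0, so the sum over blades reduces to the defect of \<open>b\<close>.\<close>
    let ?\<alpha> = "\<lambda>x. b x *\<^sub>R blade {} :: 'n clifford"
    have \<alpha>: "?\<alpha> \<in> test_functions \<Omega>" using b by (rule scaled_blade_test_function)
    then have "(LINT x|lebesgue_on \<Omega>. ?\<alpha> x \<odot> f x) + (LINT x|lebesgue_on \<Omega>. Dbar_right ?\<alpha> x \<odot> u x) = 0"
      using bspec[OF weak[unfolded weak_solution_def] \<alpha>] by simp
    then have "0 = (\<Sum>A\<in>UNIV. blade A \<odot> defect (\<lambda>x. ?\<alpha> x $ A))"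
      unfolding weak_solution_defect[OF \<alpha>] by simp
    also have "\<dots> = (\<Sum>A\<in>UNIV. if A = ({} :: 'n set) then defect b else 0)"
    proof (intro sum.cong refl)
      have "gen None = (blade {} :: 'n clifford)" by (simp add: gen_def)
      then have "blade {} \<odot> v = v" for v :: "'n clifford" using cmult_unit(1)[of v] by simp
      then show "blade A \<odot> defect (\<lambda>x. ?\<alpha> x $ A) = (if A = {} then defect b else 0)" for A
        by (auto simp: blade_nth defect_zero cmult_zero)
    qed
    finally show "defect b = 0" by simp
  qed
next
  assume "\<forall>b. smooth b \<longrightarrow> compactly_supported_in \<Omega> b \<longrightarrow> defect b = 0"
  then have "(LINT x|lebesgue_on \<Omega>. \<alpha> x \<odot> f x) + (LINT x|lebesgue_on \<Omega>. Dbar_right \<alpha> x \<odot> u x) = 0"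
    if "\<alpha> \<in> test_functions \<Omega>" for \<alpha>
    unfolding weak_solution_defect[OF that]
    using that by (simp add: test_functions_iff cmult_zero)
  then show "weak_solution \<Omega> u f"
    unfolding weak_solution_def by (intro ballI) (simp only: eq_neg_iff_add_eq_0)
qed

context
  fixes \<phi> :: "'n point \<Rightarrow> real" and \<alpha> :: "'n point \<Rightarrow> 'n clifford"
  assumes \<phi>: "Ck_on 1 \<Omega> \<phi>" and \<alpha>: "\<alpha> \<in> test_functions \<Omega>"
begin

abbreviation (input) weighted :: "'n set \<Rightarrow> 'n point \<Rightarrow> real" where
  "weighted A \<equiv> \<lambda>x. exp (- \<phi> x) * \<alpha> x $ A"

text \<open>In the second pairing exp(-phi) cancels the factor exp(phi) of the dual operator,
  leaving derivatives of the weighted components; and conj(u) conj(e_i) = conj(e_i u) recovers the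
  products e_i u of the weak equation. The minus sign of the dual makes the difference of the
  pairings a sum. Integrability is recorded for splitting integrals and taking scalar parts.\<close>

lemma
  shows integrable_ip_left: "integrable (lebesgue_on \<Omega>) (\<lambda>x. exp (- \<phi> x) *\<^sub>R (cconj (f x) \<odot> \<alpha> x))"
    and integrable_ip_right: "integrable (lebesgue_on \<Omega>) (\<lambda>x. exp (- \<phi> x) *\<^sub>R (cconj (u x) \<odot> Dbar_dual \<phi> \<alpha> x))"
    and ip_defect: "ip \<Omega> \<phi> f \<alpha> - ip \<Omega> \<phi> u (Dbar_dual \<phi> \<alpha>) =
      (\<Sum>A\<in>UNIV. cconj (defect (weighted A)) \<odot> blade A)"
proof -
  have Tf: "locally_integrable \<Omega> (\<lambda>x. cconj (f x) \<odot> blade A)" for A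
    by (rule locally_integrable_bounded_linear[OF bounded_linear_conj_blade f])
  have Tu: "locally_integrable \<Omega> (\<lambda>x. cconj (gen i \<odot> u x) \<odot> blade A)" for A i
    by (rule locally_integrable_bounded_linear[OF bounded_linear_conj_blade locally_integrable_gen_cmult])
  have fe: "exp (- \<phi> x) *\<^sub>R (cconj (f x) \<odot> \<alpha> x) = (\<Sum>A\<in>UNIV. weighted A x *\<^sub>R (cconj (f x) \<odot> blade A))" for x
    by (subst clifford_expand[of "\<alpha> x"]) (simp add: cmult_sum_right cmult_scaleR scaleR_sum_right)
  have ue: "exp (- \<phi> x) *\<^sub>R (cconj (u x) \<odot> Dbar_dual \<phi> \<alpha> x) =
      - (\<Sum>i\<in>UNIV. \<Sum>A\<in>UNIV. pd i (weighted A) x *\<^sub>R (cconj (gen i \<odot> u x) \<odot> blade A))" for x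
    unfolding Dbar_dual_eq
    by (simp add: cmult_sum_right cmult_scaleR cconj_cmult cmult_assoc bilinear_rneg[OF bilinear_cmult] exp_minus)
  note weighted = test_function_weighted[OF \<Omega> \<phi> \<alpha>]
  note int = integrable_test(1)[OF \<Omega> weighted Tf] integrable_test(2)[OF \<Omega> weighted Tu]
  show "integrable (lebesgue_on \<Omega>) (\<lambda>x. exp (- \<phi> x) *\<^sub>R (cconj (f x) \<odot> \<alpha> x))"
    unfolding fe by (intro Bochner_Integration.integrable_sum int)
  show "integrable (lebesgue_on \<Omega>) (\<lambda>x. exp (- \<phi> x) *\<^sub>R (cconj (u x) \<odot> Dbar_dual \<phi> \<alpha> x))"
    unfolding ue by (intro Bochner_Integration.integrable_minus Bochner_Integration.integrable_sum int)
  have 1: "ip \<Omega> \<phi> f \<alpha> = (\<Sum>A\<in>UNIV. LINT x|lebesgue_on \<Omega>. weighted A x *\<^sub>R (cconj (f x) \<odot> blade A))"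
    unfolding ip_def fe by (intro Bochner_Integration.integral_sum int)
  have "ip \<Omega> \<phi> u (Dbar_dual \<phi> \<alpha>) = - (\<Sum>i\<in>UNIV. \<Sum>A\<in>UNIV.
      LINT x|lebesgue_on \<Omega>. pd i (weighted A) x *\<^sub>R (cconj (gen i \<odot> u x) \<odot> blade A))"
    unfolding ip_def ue
    by (simp add: Bochner_Integration.integral_sum Bochner_Integration.integrable_sum int)
  also have "\<dots> = - (\<Sum>A\<in>UNIV. \<Sum>i\<in>UNIV.
      LINT x|lebesgue_on \<Omega>. pd i (weighted A) x *\<^sub>R (cconj (gen i \<odot> u x) \<odot> blade A))"
    by (subst sum.swap) (rule refl)
  finally show "ip \<Omega> \<phi> f \<alpha> - ip \<Omega> \<phi> u (Dbar_dual \<phi> \<alpha>) =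
      (\<Sum>A\<in>UNIV. cconj (defect (weighted A)) \<odot> blade A)"
    unfolding 1 bounded_linear_defect[OF bounded_linear_conj_blade weighted] sum.distrib by simp
qed

end

end

section \<open>Passage between the weighted and the unweighted L^2 space\<close>

lemma ip_scalar_part:
  assumes "integrable (lebesgue_on \<Omega>) (\<lambda>x. exp (- \<phi> x) *\<^sub>R (cconj (f x) \<odot> g x))"
  shows "ip \<Omega> \<phi> f g $ {} = (LINT x|lebesgue_on \<Omega>. exp (- \<phi> x) * (f x \<bullet> g x))"
  unfolding ip_def
  by (simp add: integral_bounded_linear[OF bounded_linear_vec_nth assms, symmetric] cconj_cmult_scalar_part)

lemma norm_sq_eq:
  fixes g :: "'n::{finite,linorder} point \<Rightarrow> 'n clifford"
  shows "norm_sq \<Omega> \<phi> g = 2 ^ CARD('n) * (LINT x|lebesgue_on \<Omega>. (norm (exp (- \<phi> x / 2) *\<^sub>R g x))\<^sup>2)"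
proof -
  have "(norm0 (g x))\<^sup>2 * exp (- \<phi> x) = 2 ^ CARD('n) * (norm (exp (- \<phi> x / 2) *\<^sub>R g x))\<^sup>2" for x
    by (simp add: norm0_square power_mult_distrib exp_double[symmetric])
  then show ?thesis by (simp add: norm_sq_def)
qed

lemma L2_imp_square_integrable:
  assumes \<Omega>: "open \<Omega>" and \<phi>: "continuous_on \<Omega> \<phi>" and f: "f \<in> L2 \<Omega> \<phi>"
  shows "square_integrable (lebesgue_on \<Omega>) (\<lambda>x. exp (- \<phi> x / 2) *\<^sub>R f x)"
proof -
  have w: "(\<lambda>x. exp (- \<phi> x / 2)) \<in> borel_measurable (lebesgue_on \<Omega>)"
    using \<Omega> \<phi> by (intro continuous_imp_measurable_on_sets_lebesgue continuous_intros) auto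
  have "(\<lambda>x. \<Sum>A\<in>UNIV. f x $ A *\<^sub>R blade A) \<in> borel_measurable (lebesgue_on \<Omega>)"
    using f by (intro borel_measurable_sum borel_measurable_scaleR) (auto simp: L2_def)
  then have "f \<in> borel_measurable (lebesgue_on \<Omega>)" by (simp flip: clifford_expand)
  moreover have "(norm (exp (- \<phi> x / 2) *\<^sub>R f x))\<^sup>2 = (\<Sum>A\<in>UNIV. \<bar>f x $ A\<bar>\<^sup>2 * exp (- \<phi> x))" for x
    by (simp add: power_mult_distrib exp_double[symmetric] norm_vec_def L2_set_def sum_nonneg
        sum_distrib_left mult.commute)
  ultimately show ?thesis
    using f w by (auto simp: square_integrable_def L2_def)
qed

lemma square_integrable_imp_L2:
  assumes \<Omega>: "open \<Omega>" and \<phi>: "continuous_on \<Omega> \<phi>" and v: "square_integrable (lebesgue_on \<Omega>) v"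
  shows "(\<lambda>x. exp (\<phi> x / 2) *\<^sub>R v x) \<in> L2 \<Omega> \<phi>"
  unfolding L2_def
proof (intro CollectI allI conjI)
  fix A
  have vA: "(\<lambda>x. v x $ A) \<in> borel_measurable (lebesgue_on \<Omega>)"
    using v unfolding square_integrable_def
    by (intro measurable_compose[OF _ borel_measurable_continuous_onI[OF linear_continuous_on[OF bounded_linear_vec_nth]]])
      simp
  have "(\<lambda>x. exp (\<phi> x / 2)) \<in> borel_measurable (lebesgue_on \<Omega>)"
    using \<Omega> \<phi> by (intro continuous_imp_measurable_on_sets_lebesgue continuous_intros) auto
  with vA show "(\<lambda>x. (exp (\<phi> x / 2) *\<^sub>R v x) $ A) \<in> borel_measurable (lebesgue_on \<Omega>)"
    by simp
  have eq: "\<bar>(exp (\<phi> x / 2) *\<^sub>R v x) $ A\<bar>\<^sup>2 * exp (- \<phi> x) = (v x $ A)\<^sup>2" for x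
    by (simp add: power_mult_distrib exp_double[symmetric] exp_minus)
  show "integrable (lebesgue_on \<Omega>) (\<lambda>x. \<bar>(exp (\<phi> x / 2) *\<^sub>R v x) $ A\<bar>\<^sup>2 * exp (- \<phi> x))"
    unfolding eq
  proof (rule Bochner_Integration.integrable_bound)
    show "integrable (lebesgue_on \<Omega>) (\<lambda>x. (norm (v x))\<^sup>2)" using v by (simp add: square_integrable_def)
    have "(v x $ A)\<^sup>2 \<le> (norm (v x))\<^sup>2" for x
      using component_le_norm_cart[of "v x" A] by (simp add: abs_le_square_iff[symmetric])
    then show "AE x in lebesgue_on \<Omega>. norm ((v x $ A)\<^sup>2) \<le> norm ((norm (v x))\<^sup>2)" by simp
  qed (use vA in simp)
qed

text \<open>Removing the weight gives a square integrable function, and the factor exp(phi/2) that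
  restores it is continuous on \<open>\<Omega>\<close>.\<close>

lemma L2_locally_integrable:
  assumes \<Omega>: "open \<Omega>" and \<phi>: "continuous_on \<Omega> \<phi>" and f: "f \<in> L2 \<Omega> \<phi>"
  shows "locally_integrable \<Omega> f"
proof -
  have "locally_integrable \<Omega> (\<lambda>x. exp (\<phi> x / 2) *\<^sub>R (exp (- \<phi> x / 2) *\<^sub>R f x))"
    using L2_imp_square_integrable[OF assms] \<Omega> \<phi>
    by (intro locally_integrable_scaleR square_integrable_locally_integrable continuous_intros) auto
  then show ?thesis by (simp flip: exp_add)
qed

text \<open>Submultiplicativity of \<open>norm0\<close> reduces the Clifford-valued estimate to
  Cauchy-Schwarz for the real functions \<open>N u\<close> and \<open>N g\<close>, with constant
  1.\<close>

lemma norm0_ip_square_le: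
  fixes u g :: "'n::{finite,linorder} point \<Rightarrow> 'n clifford"
  assumes u: "square_integrable (lebesgue_on \<Omega>) (\<lambda>x. exp (- \<phi> x / 2) *\<^sub>R u x)"
    and g: "square_integrable (lebesgue_on \<Omega>) (\<lambda>x. exp (- \<phi> x / 2) *\<^sub>R g x)"
  shows "(norm0 (ip \<Omega> \<phi> u g))\<^sup>2 \<le> norm_sq \<Omega> \<phi> u * norm_sq \<Omega> \<phi> g"
proof -
  define N where "N h = (\<lambda>x. norm0 (exp (- \<phi> x / 2) *\<^sub>R h x))" for h :: "'n point \<Rightarrow> 'n clifford"
  have sq: "square_integrable (lebesgue_on \<Omega>) (N h)"
    if "square_integrable (lebesgue_on \<Omega>) (\<lambda>x. exp (- \<phi> x / 2) *\<^sub>R h x)" for h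
    using that unfolding square_integrable_def N_def norm0_eq
    by (auto simp: power_mult_distrib simp del: norm_scaleR)
  have norm_sq: "norm_sq \<Omega> \<phi> h = (LINT x|lebesgue_on \<Omega>. (norm (N h x))\<^sup>2)" for h
    unfolding norm_sq_eq N_def by (simp add: norm0_square)
  have "norm0 (ip \<Omega> \<phi> u g) \<le> sqrt (2 ^ CARD('n)) *
      (LINT x|lebesgue_on \<Omega>. norm (exp (- \<phi> x) *\<^sub>R (cconj (u x) \<odot> g x)))"
    unfolding norm0_eq ip_def by (intro mult_left_mono integral_norm_bound) simp
  also have "\<dots> = (LINT x|lebesgue_on \<Omega>. norm0 (exp (- \<phi> x) *\<^sub>R (cconj (u x) \<odot> g x)))"
    by (simp add: norm0_eq)
  also have "\<dots> \<le> (LINT x|lebesgue_on \<Omega>. N u x \<bullet> N g x)"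
  proof (rule integral_mono_AE')
    show "integrable (lebesgue_on \<Omega>) (\<lambda>x. N u x \<bullet> N g x)"
      by (intro square_integrable_inner sq u g)
    have "norm0 (exp (- \<phi> x) *\<^sub>R (cconj (u x) \<odot> g x)) \<le> N u x \<bullet> N g x" for x
    proof -
      have "exp (- \<phi> x) = exp (- \<phi> x / 2) * exp (- \<phi> x / 2)" by (simp flip: exp_add)
      then have "N u x \<bullet> N g x = exp (- \<phi> x) * (norm0 (u x) * norm0 (g x))"
        by (simp add: N_def norm0_scaleR mult_ac)
      then show ?thesis
        using norm0_cmult_le[of "cconj (u x)" "g x"] by (simp add: norm0_scaleR norm0_cconj)
    qed
    then show "AE x in lebesgue_on \<Omega>. norm0 (exp (- \<phi> x) *\<^sub>R (cconj (u x) \<odot> g x)) \<le> N u x \<bullet> N g x"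
      by simp
    show "AE x in lebesgue_on \<Omega>. 0 \<le> N u x \<bullet> N g x"
      by (simp add: N_def norm0_eq)
  qed
  finally have "(norm0 (ip \<Omega> \<phi> u g))\<^sup>2 \<le> (LINT x|lebesgue_on \<Omega>. N u x \<bullet> N g x)\<^sup>2"
    by (rule power_mono) (simp add: norm0_eq)
  also have "\<dots> \<le> norm_sq \<Omega> \<phi> u * norm_sq \<Omega> \<phi> g"
    unfolding norm_sq by (intro square_integrable_Cauchy_Schwarz sq u g)
  finally show ?thesis .
qed

text \<open>The function is continuous on \<open>\<Omega>\<close> and vanishes off a finite union of
  compact sets carrying the partial derivatives of the weighted components.\<close>

lemma square_integrable_Dbar_dual:
  assumes \<Omega>: "open \<Omega>" and \<phi>: "Ck_on 1 \<Omega> \<phi>" and \<alpha>: "\<alpha> \<in> test_functions \<Omega>"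
  shows "square_integrable (lebesgue_on \<Omega>) (\<lambda>x. exp (- \<phi> x / 2) *\<^sub>R Dbar_dual \<phi> \<alpha> x)"
proof (rule square_integrable_compact_support[OF \<Omega>])
  note w = test_function_weighted[OF \<Omega> \<phi> \<alpha>]
  have cw: "continuous_on \<Omega> (pd i (\<lambda>x. exp (- \<phi> x) * \<alpha> x $ A))" for i A
    using w(1)[of A] by (simp only: Ck_on_1_iff) (auto intro: continuous_on_subset)
  then show "continuous_on \<Omega> (\<lambda>x. exp (- \<phi> x / 2) *\<^sub>R Dbar_dual \<phi> \<alpha> x)"
    unfolding Dbar_dual_eq using Ck_on_1_continuous[OF \<phi>] by (intro continuous_intros) auto
  have "\<forall>i A. \<exists>K. compact K \<and> K \<subseteq> \<Omega> \<and> (\<forall>x. x \<notin> K \<longrightarrow> pd i (\<lambda>x. exp (- \<phi> x) * \<alpha> x $ A) x = 0)"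
    using compactly_supported_in_pd[OF w(2)] by (simp add: compactly_supported_in_def)
  then obtain K where K: "\<And>i A. compact (K i A)" "\<And>i A. K i A \<subseteq> \<Omega>"
    "\<And>i A x. x \<notin> K i A \<Longrightarrow> pd i (\<lambda>x. exp (- \<phi> x) * \<alpha> x $ A) x = 0"
    unfolding choice_iff by blast
  show "compactly_supported_in \<Omega> (\<lambda>x. exp (- \<phi> x / 2) *\<^sub>R Dbar_dual \<phi> \<alpha> x)"
    unfolding compactly_supported_in_def
  proof (rule exI[of _ "\<Union>i. \<Union>A. K i A"], intro conjI allI impI)
    show "compact (\<Union>i. \<Union>A. K i A)" using K(1) by (intro compact_UN finite) auto
    show "(\<Union>i. \<Union>A. K i A) \<subseteq> \<Omega>" using K(2) by blast
    fix x assume "x \<notin> (\<Union>i. \<Union>A. K i A)"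
    then show "exp (- \<phi> x / 2) *\<^sub>R Dbar_dual \<phi> \<alpha> x = 0"
      unfolding Dbar_dual_eq using K(3) by simp
  qed
qed

lemma Dbar_dual_add_scaleR:
  assumes \<Omega>: "open \<Omega>" and \<phi>: "Ck_on 1 \<Omega> \<phi>"
    and \<alpha>: "\<alpha> \<in> test_functions \<Omega>" and \<beta>: "\<beta> \<in> test_functions \<Omega>"
  shows "Dbar_dual \<phi> (\<lambda>x. \<alpha> x + s *\<^sub>R \<beta> x) x = Dbar_dual \<phi> \<alpha> x + s *\<^sub>R Dbar_dual \<phi> \<beta> x"
proof -
  have diff: "(\<lambda>x. exp (- \<phi> x) * \<gamma> x $ A) differentiable (at x)" if "\<gamma> \<in> test_functions \<Omega>" for \<gamma> A
    using test_function_weighted(1)[OF \<Omega> \<phi> that, of A] by (simp only: Ck_on_1_iff) simp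
  have "pd i (\<lambda>x. exp (- \<phi> x) * (\<alpha> x + s *\<^sub>R \<beta> x) $ A) x =
      pd i (\<lambda>x. exp (- \<phi> x) * \<alpha> x $ A) x + s * pd i (\<lambda>x. exp (- \<phi> x) * \<beta> x $ A) x" for i A
    using pd_add_mult[OF diff[OF \<alpha>] diff[OF \<beta>], of i A s A] by (simp add: algebra_simps)
  then show ?thesis
    by (simp add: Dbar_dual_eq scaleR_add_left sum.distrib scaleR_sum_right algebra_simps)
qed

section \<open>The two implications\<close>

lemma a_priori_estimate:
  assumes \<Omega>: "open \<Omega>" and \<phi>: "Ck_on 1 \<Omega> \<phi>" and f: "f \<in> L2 \<Omega> \<phi>" and u: "u \<in> L2 \<Omega> \<phi>"
    and weak: "weak_solution \<Omega> u f" and le: "norm_sq \<Omega> \<phi> u \<le> c" and \<alpha>: "\<alpha> \<in> test_functions \<Omega>"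
  shows "(norm0 (ip \<Omega> \<phi> f \<alpha>))\<^sup>2 \<le> c * norm_sq \<Omega> \<phi> (Dbar_dual \<phi> \<alpha>)"
proof -
  note c\<phi> = Ck_on_1_continuous[OF \<phi>]
  note lf = L2_locally_integrable[OF \<Omega> c\<phi> f] and lu = L2_locally_integrable[OF \<Omega> c\<phi> u]
  have zero: "weak_pairing \<Omega> f (\<lambda>i x. gen i \<odot> u x) b = 0"
    if "Ck_on 1 UNIV b" "compactly_supported_in \<Omega> b" for b
    using weak[unfolded weak_solution_iff_defect[OF \<Omega> lf lu]]
    by (intro weak_pairing_extends[OF \<Omega> lf locally_integrable_gen_cmult[OF \<Omega> lf lu] _ that]) blast
  have "ip \<Omega> \<phi> f \<alpha> - ip \<Omega> \<phi> u (Dbar_dual \<phi> \<alpha>) = 0"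
    unfolding ip_defect[OF \<Omega> lf lu \<phi> \<alpha>] zero[OF test_function_weighted[OF \<Omega> \<phi> \<alpha>]] linear_0[OF linear_cconj]
    by (simp add: cmult_zero)
  then have "(norm0 (ip \<Omega> \<phi> f \<alpha>))\<^sup>2 = (norm0 (ip \<Omega> \<phi> u (Dbar_dual \<phi> \<alpha>)))\<^sup>2" by simp
  also have "\<dots> \<le> norm_sq \<Omega> \<phi> u * norm_sq \<Omega> \<phi> (Dbar_dual \<phi> \<alpha>)"
    by (intro norm0_ip_square_le L2_imp_square_integrable \<Omega> c\<phi> u square_integrable_Dbar_dual \<phi> \<alpha>)
  also have "\<dots> \<le> c * norm_sq \<Omega> \<phi> (Dbar_dual \<phi> \<alpha>)"
    using le by (intro mult_right_mono) (auto simp: norm_sq_eq)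
  finally show ?thesis .
qed

lemma weak_solution_if_scalar_parts:
  fixes f u :: "'n::{finite,linorder} point \<Rightarrow> 'n clifford"
  assumes \<Omega>: "open \<Omega>" and \<phi>: "Ck_on 1 \<Omega> \<phi>" and f: "locally_integrable \<Omega> f" and u: "locally_integrable \<Omega> u"
    and eq: "\<And>\<alpha>. \<alpha> \<in> test_functions \<Omega> \<Longrightarrow> ip \<Omega> \<phi> f \<alpha> $ {} = ip \<Omega> \<phi> u (Dbar_dual \<phi> \<alpha>) $ {}"
  shows "weak_solution \<Omega> u f"
  unfolding weak_solution_iff_defect[OF \<Omega> f u]
proof (intro allI impI)
  let ?P = "weak_pairing \<Omega> f (\<lambda>i x. gen i \<odot> u x)"
  have zero: "?P (\<lambda>x. exp (- 1 * \<phi> x) * b x) = 0"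
    if b: "smooth b" "compactly_supported_in \<Omega> b" for b
  proof (rule vec_eq_iff[THEN iffD2, rule_format])
    fix A :: "'n set"
    let ?\<alpha> = "\<lambda>x. b x *\<^sub>R blade A"
    have \<alpha>: "?\<alpha> \<in> test_functions \<Omega>" using b by (rule scaled_blade_test_function)
    have 0: "cconj 0 \<odot> blade B = 0" for B :: "'n set"
      by (simp add: linear_0[OF linear_cconj] cmult_zero)
    have "0 = (\<Sum>B\<in>UNIV. cconj (?P (\<lambda>x. exp (- \<phi> x) * ?\<alpha> x $ B)) \<odot> blade B) $ {}"
      unfolding ip_defect[OF \<Omega> f u \<phi> \<alpha>, symmetric] using eq[OF \<alpha>] by simp
    also have "(\<Sum>B\<in>UNIV. cconj (?P (\<lambda>x. exp (- \<phi> x) * ?\<alpha> x $ B)) \<odot> blade B) =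
       (\<Sum>B\<in>UNIV. if B = A then cconj (?P (\<lambda>x. exp (- \<phi> x) * b x)) \<odot> blade A else 0)"
      by (intro sum.cong refl) (auto simp: blade_nth defect_zero[OF \<Omega> f u] 0)
    \<comment> \<open>The scalar part of conj(P) e_A is the coordinate P_A, so running through all
      blades recovers the whole Clifford number from scalar parts.\<close>
    also have "\<dots> $ {} = blade A \<bullet> ?P (\<lambda>x. exp (- \<phi> x) * b x)"
      by (simp add: cconj_cmult_scalar_part inner_commute)
    finally show "?P (\<lambda>x. exp (- 1 * \<phi> x) * b x) $ A = 0 $ A" by (simp add: blade_inner)
  qed
  fix w :: "'n point \<Rightarrow> real" assume w: "smooth w" "compactly_supported_in \<Omega> w"
  let ?b = "\<lambda>x. exp (1 * \<phi> x) * w x"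
  note w1 = smooth_imp_Ck_on_1[OF w(1)]
  have "?P (\<lambda>x. exp (- 1 * \<phi> x) * ?b x) = 0"
    \<comment> \<open>Vanishing is known for exp(-phi) times smooth functions, whereas
      \<open>?b\<close> is only C^1; the weighted extension closes this gap.\<close>
    by (rule weak_pairing_weighted_extends[OF \<Omega> Ck_on_1_exp[OF \<phi>] f locally_integrable_gen_cmult[OF \<Omega> f u] zero
          Ck_on_1_weighted[OF \<Omega> Ck_on_1_exp[OF \<phi>] w1 w(2)]
          compactly_supported_in_weighted[OF \<Omega> Ck_on_1_exp[OF \<phi>] w1 w(2)]])
  then show "?P w = 0" by (simp add: mult.assoc[symmetric] flip: exp_add)
qed

lemma existence_from_estimate:
  fixes f :: "'n::{finite,linorder} point \<Rightarrow> 'n clifford"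
  assumes \<Omega>: "open \<Omega>" and \<phi>: "Ck_on 1 \<Omega> \<phi>" and f: "f \<in> L2 \<Omega> \<phi>" and "c \<ge> 0"
    and est: "\<And>\<alpha>. \<alpha> \<in> test_functions \<Omega> \<Longrightarrow> (norm0 (ip \<Omega> \<phi> f \<alpha>))\<^sup>2 \<le> c * norm_sq \<Omega> \<phi> (Dbar_dual \<phi> \<alpha>)"
  obtains u where "u \<in> L2 \<Omega> \<phi>" "weak_solution \<Omega> u f" "norm_sq \<Omega> \<phi> u \<le> 2 ^ CARD('n) * c"
proof -
  note c\<phi> = Ck_on_1_continuous[OF \<phi>]
  note lf = L2_locally_integrable[OF \<Omega> c\<phi> f]
  let ?M = "lebesgue_on \<Omega>"
  define V where "V \<alpha> = (\<lambda>x. exp (- \<phi> x / 2) *\<^sub>R Dbar_dual \<phi> \<alpha> x)" for \<alpha>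
  define r where "r \<alpha> = ip \<Omega> \<phi> f \<alpha> $ {}" for \<alpha>
  \<comment> \<open>The dual operator need not be injective on test functions, so the functional is
    recorded as a set of pairs.\<close>
  define G where "G = {(V \<alpha>, r \<alpha>) | \<alpha>. \<alpha> \<in> test_functions \<Omega>}"
  have bound: "(r \<alpha>)\<^sup>2 \<le> c * (LINT x|?M. (norm (V \<alpha> x))\<^sup>2)" if \<alpha>: "\<alpha> \<in> test_functions \<Omega>" for \<alpha>
  proof -
    \<comment> \<open>A coordinate is at most the Euclidean norm, and the resulting factor 2^n
      cancels the one in \<open>norm_sq\<close>: the functional is bounded with constant
      \<open>c\<close> itself.\<close>
    have "2 ^ CARD('n) * (r \<alpha>)\<^sup>2 \<le> (norm0 (ip \<Omega> \<phi> f \<alpha>))\<^sup>2"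
      unfolding norm0_square r_def
      using component_le_norm_cart[of "ip \<Omega> \<phi> f \<alpha>" "{}"]
      by (intro mult_left_mono) (auto simp: abs_le_square_iff[symmetric])
    also have "\<dots> \<le> 2 ^ CARD('n) * (c * (LINT x|?M. (norm (V \<alpha> x))\<^sup>2))"
      using est[OF \<alpha>] by (simp add: norm_sq_eq V_def mult.left_commute)
    finally show ?thesis by simp
  qed
  have lin: "V (\<lambda>x. \<alpha> x + s *\<^sub>R \<beta> x) = (\<lambda>x. V \<alpha> x + s *\<^sub>R V \<beta> x)"
       "r (\<lambda>x. \<alpha> x + s *\<^sub>R \<beta> x) = r \<alpha> + s * r \<beta>"
    if \<alpha>: "\<alpha> \<in> test_functions \<Omega>" and \<beta>: "\<beta> \<in> test_functions \<Omega>" for \<alpha> \<beta> s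
  proof -
    show "V (\<lambda>x. \<alpha> x + s *\<^sub>R \<beta> x) = (\<lambda>x. V \<alpha> x + s *\<^sub>R V \<beta> x)"
      by (simp add: V_def Dbar_dual_add_scaleR[OF \<Omega> \<phi> \<alpha> \<beta>] scaleR_add_right mult.commute)
    have "exp (- \<phi> x) *\<^sub>R (cconj (f x) \<odot> (\<alpha> x + s *\<^sub>R \<beta> x)) =
       exp (- \<phi> x) *\<^sub>R (cconj (f x) \<odot> \<alpha> x) + s *\<^sub>R (exp (- \<phi> x) *\<^sub>R (cconj (f x) \<odot> \<beta> x))" for x
      by (simp add: bilinear_radd[OF bilinear_cmult] cmult_scaleR algebra_simps)
    then have "ip \<Omega> \<phi> f (\<lambda>x. \<alpha> x + s *\<^sub>R \<beta> x) = ip \<Omega> \<phi> f \<alpha> + s *\<^sub>R ip \<Omega> \<phi> f \<beta>"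
      unfolding ip_def
      by (simp only: Bochner_Integration.integral_add integral_scaleR_right integrable_scaleR_right
          integrable_ip_left[OF \<Omega> lf lf \<phi> \<alpha>] integrable_ip_left[OF \<Omega> lf lf \<phi> \<beta>])
    then show "r (\<lambda>x. \<alpha> x + s *\<^sub>R \<beta> x) = r \<alpha> + s * r \<beta>" by (simp add: r_def)
  qed
  obtain v where v: "square_integrable ?M v" "(LINT x|?M. (norm (v x))\<^sup>2) \<le> c"
    and rep: "\<And>\<alpha>. \<alpha> \<in> test_functions \<Omega> \<Longrightarrow> (LINT x|?M. v x \<bullet> V \<alpha> x) = r \<alpha>"
  proof (rule Riesz_representation_graph[of G ?M c])
    show "square_integrable ?M w" if "(w, q) \<in> G" for w q
      using that square_integrable_Dbar_dual[OF \<Omega> \<phi>] by (auto simp: G_def V_def)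
    show "q\<^sup>2 \<le> c * (LINT x|?M. (norm (w x))\<^sup>2)" if "(w, q) \<in> G" for w q
      using that bound by (auto simp: G_def)
    show "(\<lambda>x. w x + s *\<^sub>R w' x, q + s * q') \<in> G" if wq: "(w, q) \<in> G" "(w', q') \<in> G" for w q w' q' s
    proof -
      obtain \<alpha> where \<alpha>: "\<alpha> \<in> test_functions \<Omega>" "w = V \<alpha>" "q = r \<alpha>" using wq(1) by (auto simp: G_def)
      obtain \<beta> where \<beta>: "\<beta> \<in> test_functions \<Omega>" "w' = V \<beta>" "q' = r \<beta>" using wq(2) by (auto simp: G_def)
      show ?thesis
        unfolding G_def
        by (rule CollectI, rule exI[of _ "\<lambda>x. \<alpha> x + s *\<^sub>R \<beta> x"])
          (simp only: lin[OF \<alpha>(1) \<beta>(1)] \<alpha>(2,3) \<beta>(2,3) test_functions_add_scaleR[OF \<alpha>(1) \<beta>(1)] simp_thms)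
    qed
    have "compactly_supported_in \<Omega> (\<lambda>_. 0 :: real)"
      unfolding compactly_supported_in_def by (rule exI[of _ "{}"]) simp
    then show "G \<noteq> {}" using scaled_blade_test_function[OF smooth_zero] by (auto simp: G_def)
    show "c \<ge> 0" by fact
  qed (auto simp: G_def)
  define u where "u = (\<lambda>x. exp (\<phi> x / 2) *\<^sub>R v x)"
  have u: "u \<in> L2 \<Omega> \<phi>" unfolding u_def using v(1) by (rule square_integrable_imp_L2[OF \<Omega> c\<phi>])
  note lu = L2_locally_integrable[OF \<Omega> c\<phi> u]
  have "ip \<Omega> \<phi> f \<alpha> $ {} = ip \<Omega> \<phi> u (Dbar_dual \<phi> \<alpha>) $ {}" if \<alpha>: "\<alpha> \<in> test_functions \<Omega>" for \<alpha>
  proof -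
    have "exp (- \<phi> x) * (u x \<bullet> Dbar_dual \<phi> \<alpha> x) = v x \<bullet> V \<alpha> x" for x
    proof -
      have "exp (- \<phi> x) * exp (\<phi> x / 2) = exp (- \<phi> x / 2)" by (simp flip: exp_add)
      then show ?thesis by (simp add: u_def V_def flip: mult.assoc)
    qed
    then show ?thesis
      using rep[OF \<alpha>] unfolding ip_scalar_part[OF integrable_ip_right[OF \<Omega> lf lu \<phi> \<alpha>]] r_def by simp
  qed
  then have "weak_solution \<Omega> u f" by (rule weak_solution_if_scalar_parts[OF \<Omega> \<phi> lf lu])
  moreover have "exp (- \<phi> x / 2) *\<^sub>R u x = v x" for x by (simp add: u_def flip: exp_add)
  \<comment> \<open>The factor 2^n arises only here, on returning from the Euclidean norm to
    \<open>norm0\<close>.\<close>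
  then have "norm_sq \<Omega> \<phi> u \<le> 2 ^ CARD('n) * c" using v(2) unfolding norm_sq_eq by simp
  ultimately show ?thesis using u that by blast
qed

theorem theorem1p1:
  fixes \<Omega> :: "'n::{finite,linorder} point set"
    and \<phi> :: "'n point \<Rightarrow> real"
    and c :: real
    and f :: "'n point \<Rightarrow> 'n clifford"
  assumes "open \<Omega>"
    and "Ck_on 2 \<Omega> \<phi>"
    and "c \<ge> 0"
    and "f \<in> L2 \<Omega> \<phi>"
  shows "((\<forall>\<alpha>\<in>test_functions \<Omega>.
             (norm0 (ip \<Omega> \<phi> f \<alpha>))\<^sup>2 \<le> c * norm_sq \<Omega> \<phi> (Dbar_dual \<phi> \<alpha>)) \<longrightarrow>
          (\<exists>u\<in>L2 \<Omega> \<phi>. weak_solution \<Omega> u f \<and>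
             norm_sq \<Omega> \<phi> u \<le> 2 ^ (2 * CARD('n)) * c))
       \<and> ((\<exists>u\<in>L2 \<Omega> \<phi>. weak_solution \<Omega> u f \<and> norm_sq \<Omega> \<phi> u \<le> c) \<longrightarrow>
          (\<forall>\<alpha>\<in>test_functions \<Omega>.
             (norm0 (ip \<Omega> \<phi> f \<alpha>))\<^sup>2 \<le> c * norm_sq \<Omega> \<phi> (Dbar_dual \<phi> \<alpha>)))"
proof (intro conjI impI)
  note \<phi> = Ck_on_2_imp_1[OF assms(2)]
  {
    assume est: "\<forall>\<alpha>\<in>test_functions \<Omega>.
      (norm0 (ip \<Omega> \<phi> f \<alpha>))\<^sup>2 \<le> c * norm_sq \<Omega> \<phi> (Dbar_dual \<phi> \<alpha>)"
    obtain u where u: "u \<in> L2 \<Omega> \<phi>" "weak_solution \<Omega> u f" "norm_sq \<Omega> \<phi> u \<le> 2 ^ CARD('n) * c"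
      using existence_from_estimate[OF assms(1) \<phi> assms(4,3)] est by blast
    note u(3)
    also have "2 ^ CARD('n) * c \<le> 2 ^ (2 * CARD('n)) * c"
      using assms(3) by (intro mult_right_mono power_increasing) auto
    finally show "\<exists>u\<in>L2 \<Omega> \<phi>. weak_solution \<Omega> u f \<and> norm_sq \<Omega> \<phi> u \<le> 2 ^ (2 * CARD('n)) * c"
      using u by blast
  next
    assume "\<exists>u\<in>L2 \<Omega> \<phi>. weak_solution \<Omega> u f \<and> norm_sq \<Omega> \<phi> u \<le> c"
    then show "\<forall>\<alpha>\<in>test_functions \<Omega>.
      (norm0 (ip \<Omega> \<phi> f \<alpha>))\<^sup>2 \<le> c * norm_sq \<Omega> \<phi> (Dbar_dual \<phi> \<alpha>)"
      using a_priori_estimate[OF assms(1) \<phi> assms(4)] by blast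
  }
qed

end
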